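(* Let $A$ and $X$ be compact Hausdorff spaces with $A$ second countable, and let $H$ be a separable Hilbert space. If $E,F\in\mathfrak{C}(A,X;H)$, then $\tilde{\rho}(E,F)=\|\Phi_E-\Phi_F\|$, where $\|\cdot\|$ is the operator norm of linear maps $C(A)\to\mathcal{L}^\infty(X,\mathcal{B}(H))$.
   Context: $\mathfrak{A}_A$ denotes the Borel $\sigma$-algebra of $A$, $C(A)$ the continuous complex functions on $A$ with the supremum norm, and $\mathcal{B}(H)$ the bounded operators on $H$. $Q(A;H)$ is the set of $\mathcal{B}(H)$-valued quantum probability measures on $A$: maps $E:\mathfrak{A}_A\to\mathcal{B}(H)$ such that $E(\delta)\ge 0$ for all $\delta\in\mathfrak{A}_A$, $E(\emptyset)=0$, $E(A)=I$, and $E(\bigcup_n\delta_n)=\sum_n E(\delta_n)$ in the strong operator topology for every countable family of pairwise disjoint $\delta_n\in\mathfrak{A}_A$. For $E\in Q(A;H)$ and $\xi,\eta\in H$, $E_{\xi,\eta}(\alpha)=\langle E(\alpha)\xi,\eta\rangle$, and $\phi_E:C(A)\to\mathcal{B}(H)$ is the unital completely positive map determined by $\langle\phi_E(f)\xi,\eta\rangle=\int_A f\,dE_{\xi,\eta}$. For a complex Borel measure $\mu$ on $A$, $\|\mu\|_{tv}=\sup\{\sum_{i=1}^n|\mu(\alpha_i)|\}$ over all finite Borel partitions of $A$; and $\rho(E,F)=\sup\{\|E_{\xi,\eta}-F_{\xi,\eta}\|_{tv}:\|\xi\|=\|\eta\|=1\}$. $\mathfrak{C}(A,X;H)$ is the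 set of $\mathcal{B}(H)$-valued information channels from $X$ to $A$: families $E=(E(\cdot|x))_{x\in X}$ in $Q(A;H)$ such that $x\mapsto\langle E(\alpha|x)\xi,\eta\rangle$ is Borel measurable for all $\alpha\in\mathfrak{A}_A$, $\xi,\eta\in H$. Write $E_x=E(\cdot|x)$ and $\tilde\rho(E,F)=\sup_{x\in X}\rho(E_x,F_x)$. $\mathcal{L}^\infty(X,\mathcal{B}(H))$ is the unital C*-algebra of all bounded w$^*$-measurable functions $X\to\mathcal{B}(H)$ (everywhere defined), with pointwise operations and involution and the supremum norm. For $E\in\mathfrak{C}(A,X;H)$, $\Phi_E:C(A)\to\mathcal{L}^\infty(X,\mathcal{B}(H))$ is the unital completely positive map $\Phi_E(f)(x)=\phi_{E_x}(f)$. *)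

theory Defs
  imports "HOL-Analysis.Analysis"
begin

subsection \<open>Complex Hilbert spaces and bounded operators\<close>

text \<open>The inner product is linear in the first and conjugate linear in the second
  argument, so that \<open>f \<mapsto> \<phi>\<^sub>E(f)\<close> below is complex linear.  The space may be zero
  and need not be separable.\<close>

class complex_hilbert_space = banach +
  fixes scaleC :: "complex \<Rightarrow> 'a \<Rightarrow> 'a" (infixr "*\<^sub>C" 75)
    and cinner :: "'a \<Rightarrow> 'a \<Rightarrow> complex"
  assumes scaleC_of_real: "complex_of_real r *\<^sub>C x = r *\<^sub>R x"
    and scaleC_scaleC: "a *\<^sub>C b *\<^sub>C x = (a * b) *\<^sub>C x"
    and scaleC_add_right: "a *\<^sub>C (x + y) = a *\<^sub>C x + a *\<^sub>C y"
    and scaleC_add_left: "(a + b) *\<^sub>C x = a *\<^sub>C x + b *\<^sub>C x"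
    and cinner_commute: "cinner x y = cnj (cinner y x)"
    and cinner_add_left: "cinner (x + y) z = cinner x z + cinner y z"
    and cinner_scaleC_left: "cinner (a *\<^sub>C x) y = a * cinner x y"
    and cinner_self: "cinner x x = complex_of_real ((norm x)\<^sup>2)"
begin

lemma cinner_scaleR_left: "cinner (r *\<^sub>R x) y = complex_of_real r * cinner x y"
  using cinner_scaleC_left[of "complex_of_real r" x y] by (simp only: scaleC_of_real)

lemma scaleC_minus_right: "a *\<^sub>C (- x) = - (a *\<^sub>C x)"
proof -
  have "a *\<^sub>C 0 + a *\<^sub>C 0 = a *\<^sub>C 0"
    using scaleC_add_right[of a 0 0] by simp
  then have "a *\<^sub>C 0 = 0" by simp
  then have "a *\<^sub>C x + a *\<^sub>C (- x) = 0"
    using scaleC_add_right[of a x "- x"] by simp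
  then show ?thesis by (simp add: minus_unique)
qed

lemma scaleC_scaleR: "a *\<^sub>C r *\<^sub>R x = r *\<^sub>R a *\<^sub>C x"
  by (metis scaleC_of_real scaleC_scaleC mult.commute)

end

text \<open>\<open>\<B>(H)\<close> as the complex linear elements of the real Banach space of bounded real linear
  maps; the norm of the latter is the usual operator norm.\<close>

definition bounded_ops :: "('h::complex_hilbert_space \<Rightarrow>\<^sub>L 'h) set" where
  "bounded_ops = {T. \<forall>c \<xi>. blinfun_apply T (c *\<^sub>C \<xi>) = c *\<^sub>C blinfun_apply T \<xi>}"

definition positive_op :: "('h::complex_hilbert_space \<Rightarrow>\<^sub>L 'h) \<Rightarrow> bool" where
  "positive_op T \<longleftrightarrow> T \<in> bounded_ops \<and> (\<forall>\<xi>. cinner (blinfun_apply T \<xi>) \<xi> \<in> \<real>\<^sub>\<ge>\<^sub>0)"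

lemma bounded_ops_0: "0 \<in> bounded_ops"
  and bounded_ops_add: "S \<in> bounded_ops \<Longrightarrow> T \<in> bounded_ops \<Longrightarrow> S + T \<in> bounded_ops"
  and bounded_ops_uminus: "T \<in> bounded_ops \<Longrightarrow> - T \<in> bounded_ops"
  and bounded_ops_scaleR: "T \<in> bounded_ops \<Longrightarrow> r *\<^sub>R T \<in> bounded_ops"
proof -
  have "c *\<^sub>C (0::'a) = 0" for c
    using scaleC_add_right[of c "0::'a" 0] by simp
  then show "(0 :: 'a \<Rightarrow>\<^sub>L 'a) \<in> bounded_ops"
    by (simp add: bounded_ops_def)
qed (simp_all add: bounded_ops_def plus_blinfun.rep_eq uminus_blinfun.rep_eq
      scaleR_blinfun.rep_eq scaleC_add_right scaleC_minus_right scaleC_scaleR)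


subsection \<open>Complex measures\<close>

text \<open>A complex Borel measure is a set function \<open>\<mu> :: 'a set \<Rightarrow> complex\<close> used on Borel sets only.
  The supremum is taken in \<open>[0, \<infinity>]\<close>.\<close>

definition tv_norm :: "('a::topological_space set \<Rightarrow> complex) \<Rightarrow> ennreal" where
  "tv_norm \<mu> = (SUP P \<in> {P. finite P \<and> partition_on UNIV P \<and> P \<subseteq> sets borel}.
      ennreal (\<Sum>\<alpha>\<in>P. cmod (\<mu> \<alpha>)))"

text \<open>The integral of a bounded Borel function against a complex measure \<open>\<mu>\<close> is
  \<open>\<integral>f dM\<^sub>0 + \<i> \<integral>f dM\<^sub>1 - \<integral>f dM\<^sub>2 - \<i> \<integral>f dM\<^sub>3\<close> for any finite positive measures with
  \<open>\<mu> = M\<^sub>0 + \<i> M\<^sub>1 - M\<^sub>2 - \<i> M\<^sub>3\<close> (for instance those of the Jordan decompositions of the real and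
  the imaginary part); the value does not depend on the choice.\<close>

definition complex_measure_integral ::
    "('a::topological_space set \<Rightarrow> complex) \<Rightarrow> ('a \<Rightarrow> complex) \<Rightarrow> complex" where
  "complex_measure_integral \<mu> f = (THE I. \<exists>M :: nat \<Rightarrow> 'a measure.
      (\<forall>k<4. sets (M k) = sets borel \<and> finite_measure (M k)) \<and>
      (\<forall>\<alpha>\<in>sets borel. \<mu> \<alpha> = (\<Sum>k<4. \<i> ^ k * complex_of_real (measure (M k) \<alpha>))) \<and>
      I = (\<Sum>k<4. \<i> ^ k * (LINT t|M k. f t)))"


subsection \<open>Quantum probability measures and information channels\<close>

definition quantum_prob_measures ::
    "('a::topological_space set \<Rightarrow> ('h::complex_hilbert_space \<Rightarrow>\<^sub>L 'h)) set" where
  "quantum_prob_measures = {E.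
      (\<forall>\<delta>\<in>sets borel. positive_op (E \<delta>)) \<and>
      E {} = 0 \<and> E UNIV = id_blinfun \<and>
      (\<forall>\<delta> :: nat \<Rightarrow> 'a set. range \<delta> \<subseteq> sets borel \<longrightarrow> disjoint_family \<delta> \<longrightarrow>
        (\<forall>\<xi>. (\<lambda>n. blinfun_apply (E (\<delta> n)) \<xi>) sums blinfun_apply (E (\<Union>n. \<delta> n)) \<xi>))}"

definition coeff_measure ::
    "('a set \<Rightarrow> ('h::complex_hilbert_space \<Rightarrow>\<^sub>L 'h)) \<Rightarrow> 'h \<Rightarrow> 'h \<Rightarrow> 'a set \<Rightarrow> complex" where
  "coeff_measure E \<xi> \<eta> \<alpha> = cinner (blinfun_apply (E \<alpha>) \<xi>) \<eta>"

definition qpm_dist ::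
    "('a::topological_space set \<Rightarrow> ('h::complex_hilbert_space \<Rightarrow>\<^sub>L 'h)) \<Rightarrow>
     ('a set \<Rightarrow> ('h \<Rightarrow>\<^sub>L 'h)) \<Rightarrow> ennreal" where
  "qpm_dist E F = (SUP (\<xi>, \<eta>) \<in> {(\<xi>, \<eta>). norm \<xi> = 1 \<and> norm \<eta> = 1}.
      tv_norm (\<lambda>\<alpha>. coeff_measure E \<xi> \<eta> \<alpha> - coeff_measure F \<xi> \<eta> \<alpha>))"

text \<open>\<open>E x \<alpha>\<close> stands for \<open>E(\<alpha>|x)\<close>.\<close>

definition channels ::
    "('x::topological_space \<Rightarrow> 'a::topological_space set \<Rightarrow>
      ('h::complex_hilbert_space \<Rightarrow>\<^sub>L 'h)) set" where
  "channels = {E. (\<forall>x. E x \<in> quantum_prob_measures) \<and>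
      (\<forall>\<alpha>\<in>sets borel. \<forall>\<xi> \<eta>. (\<lambda>x. coeff_measure (E x) \<xi> \<eta> \<alpha>) \<in> borel_measurable borel)}"

definition channel_dist ::
    "('x \<Rightarrow> 'a::topological_space set \<Rightarrow> ('h::complex_hilbert_space \<Rightarrow>\<^sub>L 'h)) \<Rightarrow>
     ('x \<Rightarrow> 'a set \<Rightarrow> ('h \<Rightarrow>\<^sub>L 'h)) \<Rightarrow> ennreal" where
  "channel_dist E F = (SUP x. qpm_dist (E x) (F x))"


subsection \<open>Bounded w*-measurable functions\<close>

text \<open>The w*-continuous functionals on \<open>\<B>(H)\<close>, that is, the elements of its predual, are
  \<open>T \<mapsto> \<Sum>\<^sub>n \<langle>T \<xi>\<^sub>n, \<eta>\<^sub>n\<rangle>\<close> with \<open>\<Sum>\<^sub>n \<parallel>\<xi>\<^sub>n\<parallel>\<^sup>2 < \<infinity>\<close> and \<open>\<Sum>\<^sub>n \<parallel>\<eta>\<^sub>n\<parallel>\<^sup>2 < \<infinity>\<close>.\<close>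

definition normal_functionals ::
    "(('h::complex_hilbert_space \<Rightarrow>\<^sub>L 'h) \<Rightarrow> complex) set" where
  "normal_functionals = {\<omega>. \<exists>\<xi> \<eta> :: nat \<Rightarrow> 'h.
      summable (\<lambda>n. (norm (\<xi> n))\<^sup>2) \<and> summable (\<lambda>n. (norm (\<eta> n))\<^sup>2) \<and>
      (\<forall>T\<in>bounded_ops. (\<lambda>n. cinner (blinfun_apply T (\<xi> n)) (\<eta> n)) sums \<omega> T)}"

lemma normal_functionals_0: "\<omega> \<in> normal_functionals \<Longrightarrow> \<omega> 0 = 0"
proof -
  have [simp]: "cinner (0::'a) x = 0" for x
    using cinner_add_left[of "0::'a" 0 x] by simp
  assume "\<omega> \<in> normal_functionals"
  then have "(\<lambda>n. 0) sums \<omega> 0"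
    using bounded_ops_0 by (fastforce simp: normal_functionals_def)
  then show ?thesis using sums_unique2 sums_zero by blast
qed

lemma normal_functionals_add:
  assumes "\<omega> \<in> normal_functionals" "S \<in> bounded_ops" "T \<in> bounded_ops"
  shows "\<omega> (S + T) = \<omega> S + \<omega> T"
proof -
  obtain \<xi> \<eta> where *: "\<forall>T\<in>bounded_ops. (\<lambda>n. cinner (blinfun_apply T (\<xi> n)) (\<eta> n)) sums \<omega> T"
    using assms(1) by (auto simp: normal_functionals_def)
  have "(\<lambda>n. cinner (blinfun_apply (S + T) (\<xi> n)) (\<eta> n)) sums (\<omega> S + \<omega> T)"
    unfolding plus_blinfun.rep_eq cinner_add_left using * assms by (intro sums_add) auto
  with * assms show ?thesis by (metis bounded_ops_add sums_unique2)
qed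

lemma normal_functionals_scaleR:
  assumes "\<omega> \<in> normal_functionals" "T \<in> bounded_ops"
  shows "\<omega> (r *\<^sub>R T) = complex_of_real r * \<omega> T"
proof -
  obtain \<xi> \<eta> where *: "\<forall>T\<in>bounded_ops. (\<lambda>n. cinner (blinfun_apply T (\<xi> n)) (\<eta> n)) sums \<omega> T"
    using assms(1) by (auto simp: normal_functionals_def)
  have "(\<lambda>n. cinner (blinfun_apply (r *\<^sub>R T) (\<xi> n)) (\<eta> n)) sums (complex_of_real r * \<omega> T)"
    unfolding scaleR_blinfun.rep_eq cinner_scaleR_left using * assms by (intro sums_mult) auto
  with * assms show ?thesis by (metis bounded_ops_scaleR sums_unique2)
qed

lemma normal_functionals_uminus:
  assumes "\<omega> \<in> normal_functionals" "T \<in> bounded_ops"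
  shows "\<omega> (- T) = - \<omega> T"
  using normal_functionals_scaleR[OF assms, of "-1"] by simp

definition wstar_bounded :: "('x::topological_space \<Rightarrow> ('h::complex_hilbert_space \<Rightarrow>\<^sub>L 'h)) set" where
  "wstar_bounded = {G. range G \<subseteq> bounded_ops \<and> bounded (range G) \<and>
      (\<forall>\<omega>\<in>normal_functionals. (\<lambda>x. \<omega> (G x)) \<in> borel_measurable borel)}"

lemma wstar_bounded_0: "(\<lambda>x. 0) \<in> wstar_bounded"
  by (auto simp: wstar_bounded_def bounded_ops_0)

lemma wstar_bounded_add:
  assumes "F \<in> wstar_bounded" "G \<in> wstar_bounded"
  shows "(\<lambda>x. F x + G x) \<in> wstar_bounded"
proof -
  have "F x \<in> bounded_ops" "G x \<in> bounded_ops" for x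
    using assms by (auto simp: wstar_bounded_def)
  then show ?thesis
    using assms
    by (auto simp: wstar_bounded_def bounded_ops_add normal_functionals_add
        intro!: bounded_plus_comp borel_measurable_add)
qed

lemma wstar_bounded_scaleR:
  assumes "F \<in> wstar_bounded"
  shows "(\<lambda>x. r *\<^sub>R F x) \<in> wstar_bounded"
proof -
  have "F x \<in> bounded_ops" for x
    using assms by (auto simp: wstar_bounded_def)
  then show ?thesis
    using assms
    by (auto simp: wstar_bounded_def bounded_ops_scaleR normal_functionals_scaleR
        intro!: bounded_scaleR_comp borel_measurable_times)
qed

lemma wstar_bounded_uminus: "F \<in> wstar_bounded \<Longrightarrow> (\<lambda>x. - F x) \<in> wstar_bounded"
  using wstar_bounded_scaleR[of F "-1"] by simp

lemma wstar_bounded_diff: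
  "F \<in> wstar_bounded \<Longrightarrow> G \<in> wstar_bounded \<Longrightarrow> (\<lambda>x. F x - G x) \<in> wstar_bounded"
  using wstar_bounded_add[OF _ wstar_bounded_uminus, of F G] by simp

typedef (overloaded) ('x, 'h) linf =
    "wstar_bounded :: ('x::topological_space \<Rightarrow> ('h::complex_hilbert_space \<Rightarrow>\<^sub>L 'h)) set"
  morphisms apply_linf Abs_linf
  using wstar_bounded_0 by blast

setup_lifting type_definition_linf

lemma linf_eqI: "(\<And>x. apply_linf F x = apply_linf G x) \<Longrightarrow> F = G"
  by transfer auto

lemma bounded_range_linf: "bounded (range (apply_linf F))"
  using apply_linf[of F] by (simp add: wstar_bounded_def)

instantiation linf :: (topological_space, complex_hilbert_space) real_vector
begin

lift_definition zero_linf :: "('a, 'b) linf" is "\<lambda>x. 0"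
  by (rule wstar_bounded_0)

lift_definition plus_linf :: "('a, 'b) linf \<Rightarrow> ('a, 'b) linf \<Rightarrow> ('a, 'b) linf"
  is "\<lambda>F G x. F x + G x" by (rule wstar_bounded_add)

lift_definition minus_linf :: "('a, 'b) linf \<Rightarrow> ('a, 'b) linf \<Rightarrow> ('a, 'b) linf"
  is "\<lambda>F G x. F x - G x" by (rule wstar_bounded_diff)

lift_definition uminus_linf :: "('a, 'b) linf \<Rightarrow> ('a, 'b) linf"
  is "\<lambda>F x. - F x" by (rule wstar_bounded_uminus)

lift_definition scaleR_linf :: "real \<Rightarrow> ('a, 'b) linf \<Rightarrow> ('a, 'b) linf"
  is "\<lambda>r F x. r *\<^sub>R F x" by (rule wstar_bounded_scaleR)

instance
  by standard (transfer; simp add: algebra_simps)+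

end

instantiation linf :: (topological_space, complex_hilbert_space) real_normed_vector
begin

definition norm_linf :: "('a, 'b) linf \<Rightarrow> real" where
  "norm_linf F = (SUP x. norm (apply_linf F x))"

definition dist_linf :: "('a, 'b) linf \<Rightarrow> ('a, 'b) linf \<Rightarrow> real" where
  "dist_linf F G = norm (F - G)"

definition sgn_linf :: "('a, 'b) linf \<Rightarrow> ('a, 'b) linf" where
  "sgn_linf F = F /\<^sub>R norm F"

definition uniformity_linf :: "(('a, 'b) linf \<times> ('a, 'b) linf) filter" where
  "uniformity_linf = (INF e\<in>{0 <..}. principal {(x, y). dist x y < e})"

definition open_linf :: "('a, 'b) linf set \<Rightarrow> bool" where
  "open_linf S = (\<forall>x\<in>S. \<forall>\<^sub>F (x', y) in uniformity. x' = x \<longrightarrow> y \<in> S)"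

instance
proof
  have bdd: "bdd_above (range (\<lambda>x. norm (apply_linf F x)))" for F :: "('a, 'b) linf"
    by (rule bounded_imp_bdd_above) (simp add: bounded_norm_comp bounded_range_linf)
  have upper: "norm (apply_linf F x) \<le> norm F" for F :: "('a, 'b) linf" and x
    unfolding norm_linf_def by (rule cSUP_upper[OF UNIV_I bdd])
  fix F G :: "('a, 'b) linf" and a :: real
  show "dist F G = norm (F - G)" by (rule dist_linf_def)
  show "sgn F = F /\<^sub>R norm F" by (rule sgn_linf_def)
  show "uniformity = (INF e\<in>{0 <..}. principal {(x, y :: ('a, 'b) linf). dist x y < e})"
    by (rule uniformity_linf_def)
  show "open S = (\<forall>x\<in>S. \<forall>\<^sub>F (x', y) in uniformity. x' = x \<longrightarrow> y \<in> S)"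
    for S :: "('a, 'b) linf set"
    by (rule open_linf_def)
  show "(norm F = 0) = (F = 0)"
  proof
    assume "norm F = 0"
    then have "apply_linf F x = 0" for x using upper[of F x] by simp
    then show "F = 0" by (auto intro: linf_eqI simp: zero_linf.rep_eq)
  next
    assume "F = 0"
    then show "norm F = 0" by (simp add: norm_linf_def zero_linf.rep_eq)
  qed
  show "norm (F + G) \<le> norm F + norm G"
    unfolding norm_linf_def[of "F + G"]
    by (rule cSUP_least)
       (auto simp: plus_linf.rep_eq intro!: norm_triangle_le add_mono upper)
  have le: "norm (r *\<^sub>R G) \<le> \<bar>r\<bar> * norm G" for r and G :: "('a, 'b) linf"
    unfolding norm_linf_def[of "r *\<^sub>R G"]
    by (rule cSUP_least) (auto simp: scaleR_linf.rep_eq intro!: mult_left_mono upper)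
  show "norm (a *\<^sub>R F) = \<bar>a\<bar> * norm F"
  proof (cases "a = 0")
    case True
    then show ?thesis by (simp add: norm_linf_def zero_linf.rep_eq)
  next
    case False
    then have "\<bar>a\<bar> * norm F \<le> norm (a *\<^sub>R F)"
      using le[of "inverse a" "a *\<^sub>R F"] by (simp add: field_simps)
    with le[of a F] show ?thesis by simp
  qed
qed

end


subsection \<open>The unital completely positive maps of a channel\<close>

definition phi ::
    "('a::topological_space set \<Rightarrow> ('h::complex_hilbert_space \<Rightarrow>\<^sub>L 'h)) \<Rightarrow>
     ('a \<Rightarrow>\<^sub>C complex) \<Rightarrow> ('h \<Rightarrow>\<^sub>L 'h)" where
  "phi E f = (THE T. T \<in> bounded_ops \<and>
      (\<forall>\<xi> \<eta>. cinner (blinfun_apply T \<xi>) \<eta> =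
        complex_measure_integral (coeff_measure E \<xi> \<eta>) (apply_bcontfun f)))"

text \<open>For a channel \<open>E\<close> on a compact Hausdorff space \<open>A\<close>, the function \<open>x \<mapsto> \<phi>\<^bsub>E x\<^esub>(f)\<close> is bounded
  and w*-measurable, so \<open>Abs_linf\<close> is applied to an element of its domain; and \<open>'a \<Rightarrow>\<^sub>C complex\<close> is
  all of \<open>C(A)\<close>.\<close>

definition Phi ::
    "('x::topological_space \<Rightarrow> 'a::topological_space set \<Rightarrow> ('h::complex_hilbert_space \<Rightarrow>\<^sub>L 'h)) \<Rightarrow>
     ('a \<Rightarrow>\<^sub>C complex) \<Rightarrow> ('x, 'h) linf" where
  "Phi E f = Abs_linf (\<lambda>x. phi (E x) f)"

end

theory Submission
  imports Defs
begin

text \<open>Fix a point \<open>x\<close> and unit vectors \<open>\<xi>\<close>, \<open>\<eta>\<close>, and let \<open>\<mu>\<close> be the complex measure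
  \<open>E\<^sub>\<xi>\<^sub>,\<^sub>\<eta> - F\<^sub>\<xi>\<^sub>,\<^sub>\<eta>\<close> at \<open>x\<close>.  Then \<open>\<langle>(\<Phi>\<^sub>E(f)(x) - \<Phi>\<^sub>F(f)(x)) \<xi>, \<eta>\<rangle> = \<integral>f d\<mu>\<close>, and the norm of
  \<open>f \<mapsto> \<integral>f d\<mu>\<close> on \<open>C(A)\<close> is the total variation of \<open>\<mu>\<close>.  The operator norm of \<open>\<Phi>\<^sub>E - \<Phi>\<^sub>F\<close> and the
  distance of the channels are therefore the same supremum over \<open>f\<close>, \<open>x\<close>, \<open>\<xi>\<close>, \<open>\<eta>\<close> and partitions,
  taken in different orders.

  Polarization writes every \<open>E\<^sub>\<xi>\<^sub>,\<^sub>\<eta>\<close> as a combination of four finite positive measures, and \<open>\<mu>\<close> as one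
  of eight.  For such a combination, \<open>|\<integral>f d\<mu>| \<le> \<parallel>f\<parallel> \<parallel>\<mu>\<parallel>\<^sub>t\<^sub>v\<close> follows by Riemann sums over partitions
  on whose sets \<open>f\<close> is almost constant (\<open>functional_le_variation\<close>).  The reverse inequality
  (\<open>variation_le_dual_norm\<close>) needs, for a Borel partition, a continuous \<open>f\<close> with \<open>\<parallel>f\<parallel> \<le> 1\<close> for which
  \<open>\<integral>f d\<mu>\<close> is close to \<open>\<Sum>|\<mu>(\<alpha>)|\<close>.  Continuous functions are \<open>L\<^sup>1\<close> dense for finitely many measures
  simultaneously: indicators of open sets are pointwise limits of continuous functions by Urysohn's
  lemma and the Lindeloef property, and the sets with approximable indicators form a Dynkin system.
  Composition with the retraction onto the unit disc is a contraction, so it makes the approximants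
  bounded by one without loss.

  The same Riemann sums show that the maps are well defined.  Their error is uniform over unit
  vectors, so the operators \<open>\<Sum> f(t\<^sub>\<alpha>) E(\<alpha>)\<close> converge in norm to \<open>\<phi>\<^sub>E(f)\<close>; and the partitions depend
  on \<open>f\<close> alone, which gives the measurability of \<open>x \<mapsto> \<phi>\<^bsub>E x\<^esub>(f)\<close>.\<close>


section \<open>The inner product and the operator norm\<close>

lemma cinner_zero_left: "cinner 0 (y :: 'h::complex_hilbert_space) = 0"
  using cinner_add_left[of "0::'h" 0 y] by simp

lemma cinner_diff_left:
  "cinner (x - y) (z :: 'h::complex_hilbert_space) = cinner x z - cinner y z"
  using cinner_add_left[of "x - y" y z] by simp

lemma cinner_sum_left:
  "cinner (\<Sum>i\<in>I. f i) (z :: 'h::complex_hilbert_space) = (\<Sum>i\<in>I. cinner (f i) z)"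
  by (induction I rule: infinite_finite_induct) (simp_all add: cinner_zero_left cinner_add_left)

lemma cinner_add_right:
  "cinner x (y + z :: 'h::complex_hilbert_space) = cinner x y + cinner x z"
  by (metis cinner_add_left cinner_commute complex_cnj_add)

lemma cinner_scaleC_right:
  "cinner x (a *\<^sub>C y :: 'h::complex_hilbert_space) = cnj a * cinner x y"
  by (metis cinner_scaleC_left cinner_commute complex_cnj_mult)

lemma cinner_scaleR_right:
  "cinner x (r *\<^sub>R y :: 'h::complex_hilbert_space) = complex_of_real r * cinner x y"
  using cinner_scaleC_right[of x "complex_of_real r" y] by (simp add: scaleC_of_real)

lemma cinner_diff_right:
  "cinner x (y - z :: 'h::complex_hilbert_space) = cinner x y - cinner x z"
  using cinner_add_right[of x "y - z" z] by simp

lemma norm_scaleC: "norm (c *\<^sub>C x :: 'h::complex_hilbert_space) = cmod c * norm x"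
proof -
  have "complex_of_real ((norm (c *\<^sub>C x))\<^sup>2) = (c * cnj c) * complex_of_real ((norm x)\<^sup>2)"
    unfolding cinner_self[symmetric] cinner_scaleC_left cinner_scaleC_right by (simp add: mult_ac)
  also have "\<dots> = complex_of_real ((cmod c * norm x)\<^sup>2)"
    by (simp add: complex_norm_square[symmetric] power_mult_distrib)
  finally show ?thesis
    by (simp only: of_real_eq_iff) (simp add: power2_eq_iff_nonneg)
qed

lemma cinner_Cauchy_Schwarz: "cmod (cinner x (y :: 'h::complex_hilbert_space)) \<le> norm x * norm y"
proof (cases "y = 0")
  case True
  then show ?thesis
    by (metis cinner_commute cinner_zero_left complex_cnj_zero norm_zero mult_zero_right order_refl)
next
  case False
  let ?n = "complex_of_real ((norm y)\<^sup>2)" and ?a = "cinner x y"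
  \<comment> \<open>a multiple of the component of \<open>x\<close> orthogonal to \<open>y\<close>, scaled to avoid a division\<close>
  let ?z = "?n *\<^sub>C x - ?a *\<^sub>C y"
  have ya: "cinner y x = cnj ?a" by (rule cinner_commute)
  have "complex_of_real ((norm ?z)\<^sup>2) =
      ?n * ?n * complex_of_real ((norm x)\<^sup>2) - ?n * (?a * cnj ?a)"
    unfolding cinner_self[symmetric, of ?z]
      cinner_diff_left cinner_diff_right cinner_scaleC_left cinner_scaleC_right
    by (simp add: cinner_self ya algebra_simps del: of_real_power)
  also have "?a * cnj ?a = complex_of_real ((cmod ?a)\<^sup>2)"
    by (rule complex_norm_square[symmetric])
  also have "?n * ?n * complex_of_real ((norm x)\<^sup>2) - ?n * complex_of_real ((cmod ?a)\<^sup>2) =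
      complex_of_real ((norm y)\<^sup>2 * ((norm x * norm y)\<^sup>2 - (cmod ?a)\<^sup>2))"
    by (simp add: algebra_simps power2_eq_square)
  finally have "(norm ?z)\<^sup>2 = (norm y)\<^sup>2 * ((norm x * norm y)\<^sup>2 - (cmod ?a)\<^sup>2)"
    by (simp only: of_real_eq_iff)
  then have "0 \<le> (norm y)\<^sup>2 * ((norm x * norm y)\<^sup>2 - (cmod ?a)\<^sup>2)"
    by (metis zero_le_power2)
  with False have "(cmod ?a)\<^sup>2 \<le> (norm x * norm y)\<^sup>2"
    by (simp add: zero_le_mult_iff)
  then show ?thesis by (rule power2_le_imp_le) simp
qed

lemma bounded_linear_cinner_left: "bounded_linear (\<lambda>x :: 'h::complex_hilbert_space. cinner x y)"
proof (rule bounded_linear_intro)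
  show "norm (cinner x y) \<le> norm x * norm y" for x by (rule cinner_Cauchy_Schwarz)
qed (simp_all add: cinner_add_left cinner_scaleR_left scaleR_conv_of_real)

lemma bounded_linear_scaleC: "bounded_linear (\<lambda>x :: 'h::complex_hilbert_space. c *\<^sub>C x)"
proof (rule bounded_linear_intro)
  show "norm (c *\<^sub>C x) \<le> norm x * cmod c" for x :: 'h by (simp add: norm_scaleC)
qed (simp_all add: scaleC_add_right scaleC_scaleR)

text \<open>It suffices to test \<open>\<xi>\<close> and the vector \<open>T \<xi>\<close>, both normalised.  If \<open>H = 0\<close> there are no
  unit vectors and the hypothesis is void, but then \<open>T = 0\<close>.\<close>

lemma norm_blinfun_le_unit_forms:
  fixes T :: "'h::complex_hilbert_space \<Rightarrow>\<^sub>L 'h"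
  assumes "0 \<le> b"
    and unit: "\<And>\<xi> \<eta>. norm \<xi> = 1 \<Longrightarrow> norm \<eta> = 1 \<Longrightarrow> cmod (cinner (blinfun_apply T \<xi>) \<eta>) \<le> b"
  shows "norm T \<le> b"
proof (rule norm_blinfun_bound[OF \<open>0 \<le> b\<close>])
  fix \<xi> :: 'h
  let ?y = "blinfun_apply T \<xi>"
  show "norm ?y \<le> b * norm \<xi>"
  proof (cases "?y = 0")
    case True
    then show ?thesis using \<open>0 \<le> b\<close> by simp
  next
    case False
    then have "\<xi> \<noteq> 0" by auto
    have "cinner (blinfun_apply T (\<xi> /\<^sub>R norm \<xi>)) (?y /\<^sub>R norm ?y) =
        complex_of_real (norm ?y / norm \<xi>)"
      using False
      by (simp add: blinfun.scaleR_right cinner_scaleR_left cinner_scaleR_right cinner_self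
          power2_eq_square field_simps)
    then have "norm ?y / norm \<xi> = cmod (cinner (blinfun_apply T (\<xi> /\<^sub>R norm \<xi>)) (?y /\<^sub>R norm ?y))"
      by (simp add: norm_divide)
    also have "\<dots> \<le> b"
      using False \<open>\<xi> \<noteq> 0\<close> by (intro unit) simp_all
    finally show ?thesis using \<open>\<xi> \<noteq> 0\<close> by (simp add: field_simps)
  qed
qed

lemma cinner_blinfun_le_norm:
  fixes T :: "'h::complex_hilbert_space \<Rightarrow>\<^sub>L 'h"
  assumes "norm \<xi> = 1" "norm \<eta> = 1"
  shows "cmod (cinner (blinfun_apply T \<xi>) \<eta>) \<le> norm T"
  using order_trans[OF cinner_Cauchy_Schwarz, of "blinfun_apply T \<xi>" \<eta> "norm T"] assms
    norm_blinfun[of T \<xi>] by simp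

lemma blinfun_eqI_cinner:
  fixes S T :: "'h::complex_hilbert_space \<Rightarrow>\<^sub>L 'h"
  assumes "\<And>\<xi> \<eta>. cinner (blinfun_apply S \<xi>) \<eta> = cinner (blinfun_apply T \<xi>) \<eta>"
  shows "S = T"
proof -
  have "norm (S - T) \<le> 0"
    by (rule norm_blinfun_le_unit_forms) (simp_all add: blinfun.diff_left cinner_diff_left assms)
  then show ?thesis by simp
qed


section \<open>Linear combinations of finite measures\<close>

definition fine_partition :: "('a::topological_space \<Rightarrow> complex) \<Rightarrow> real \<Rightarrow> 'a set set \<Rightarrow> bool" where
  "fine_partition f \<epsilon> P \<longleftrightarrow> finite P \<and> partition_on UNIV P \<and> P \<subseteq> sets borel \<and>
     (\<forall>\<alpha>\<in>P. \<forall>s\<in>\<alpha>. \<forall>t\<in>\<alpha>. cmod (f s - f t) \<le> \<epsilon>)"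

text \<open>Riemann sums.  The sample points depend on the partition alone, so that one and the same sum can
  be formed for all measures at once; this is what makes integrals measurable in a parameter.\<close>

definition step_sum :: "('a \<Rightarrow> complex) \<Rightarrow> 'a set set \<Rightarrow> ('a set \<Rightarrow> complex) \<Rightarrow> complex" where
  "step_sum f P \<mu> = (\<Sum>\<alpha>\<in>P. f (SOME t. t \<in> \<alpha>) * \<mu> \<alpha>)"

lemma ex_fine_partition:
  fixes f :: "'a::topological_space \<Rightarrow> complex"
  assumes [measurable]: "f \<in> borel_measurable borel"
    and bound: "\<And>t. cmod (f t) \<le> B" and "\<epsilon> > 0"
  shows "\<exists>P. fine_partition f \<epsilon> P"
proof -
  \<comment> \<open>the level sets of the index of the square of side \<open>\<epsilon> / 2\<close> in which \<open>f\<close> lies\<close>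
  define h :: "'a \<Rightarrow> int \<times> int"
    where "h t = (\<lfloor>2 * Re (f t) / \<epsilon>\<rfloor>, \<lfloor>2 * Im (f t) / \<epsilon>\<rfloor>)" for t
  define P where "P = (\<lambda>z. h -` {z}) ` range h"
  have h_meas: "h -` {z} \<in> sets borel" for z
  proof -
    have "h -` {z} = {t. \<lfloor>2 * Re (f t) / \<epsilon>\<rfloor> = fst z} \<inter> {t. \<lfloor>2 * Im (f t) / \<epsilon>\<rfloor> = snd z}"
      by (auto simp: h_def)
    also have "\<dots> \<in> sets borel" by measurable
    finally show ?thesis .
  qed
  have "range h \<subseteq> {\<lfloor>- (2 * B / \<epsilon>)\<rfloor>..\<lfloor>2 * B / \<epsilon>\<rfloor>} \<times> {\<lfloor>- (2 * B / \<epsilon>)\<rfloor>..\<lfloor>2 * B / \<epsilon>\<rfloor>}"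
  proof -
    have "- (2 * B / \<epsilon>) \<le> 2 * r / \<epsilon> \<and> 2 * r / \<epsilon> \<le> 2 * B / \<epsilon>" if "\<bar>r\<bar> \<le> B" for r
    proof -
      have "- B \<le> r" "r \<le> B" using that by auto
      then show ?thesis using \<open>\<epsilon> > 0\<close> by (simp add: field_simps)
    qed
    moreover have "\<bar>Re (f t)\<bar> \<le> B" "\<bar>Im (f t)\<bar> \<le> B" for t
      using bound[of t] abs_Re_le_cmod[of "f t"] abs_Im_le_cmod[of "f t"] by linarith+
    ultimately show ?thesis by (auto simp: h_def intro!: floor_mono)
  qed
  then have "finite (range h)" by (rule finite_subset) simp
  then have "finite P" by (simp add: P_def)
  moreover have "partition_on UNIV P"
    by (rule partition_onI) (auto simp: P_def disjnt_def)
  moreover have "P \<subseteq> sets borel" using h_meas by (auto simp: P_def)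
  moreover have "cmod (f s - f t) \<le> \<epsilon>" if "\<alpha> \<in> P" "s \<in> \<alpha>" "t \<in> \<alpha>" for \<alpha> s t
  proof -
    have eq: "h s = h t" using that by (auto simp: P_def)
    have close: "\<bar>u - v\<bar> \<le> \<epsilon> / 2" if "\<lfloor>2 * u / \<epsilon>\<rfloor> = \<lfloor>2 * v / \<epsilon>\<rfloor>" for u v
    proof -
      have "\<bar>2 * u / \<epsilon> - 2 * v / \<epsilon>\<bar> \<le> 1" using that by linarith
      then have "\<bar>2 * u / \<epsilon> - 2 * v / \<epsilon>\<bar> * \<epsilon> \<le> \<epsilon>" using \<open>\<epsilon> > 0\<close> by simp
      moreover have "\<bar>2 * u / \<epsilon> - 2 * v / \<epsilon>\<bar> * \<epsilon> = \<bar>(2 * u / \<epsilon> - 2 * v / \<epsilon>) * \<epsilon>\<bar>"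
        using \<open>\<epsilon> > 0\<close> by (simp add: abs_mult)
      moreover have "(2 * u / \<epsilon> - 2 * v / \<epsilon>) * \<epsilon> = 2 * (u - v)"
        using \<open>\<epsilon> > 0\<close> by (simp add: field_simps)
      ultimately have "\<bar>2 * (u - v)\<bar> \<le> \<epsilon>" by metis
      then have "2 * \<bar>u - v\<bar> \<le> \<epsilon>" by (simp only: abs_mult abs_numeral)
      then show ?thesis by simp
    qed
    have "cmod (f s - f t) \<le> \<bar>Re (f s - f t)\<bar> + \<bar>Im (f s - f t)\<bar>" by (rule cmod_le)
    also have "\<dots> \<le> \<epsilon> / 2 + \<epsilon> / 2"
      using eq close by (intro add_mono) (simp_all add: h_def)
    finally show ?thesis by simp
  qed
  ultimately show ?thesis by (auto simp: fine_partition_def)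
qed

text \<open>A complex measure enters every argument below through a representation as a finite linear
  combination \<open>\<Sum>\<^sub>k c\<^sub>k M\<^sub>k\<close> of finite positive measures: the two definitions that follow are the measure
  and the integral that belong to it.  The index set is arbitrary, so that the difference of two
  combinations is again one, over the disjoint sum of the index sets.\<close>

locale measure_combination =
  fixes K :: "'k set" and c :: "'k \<Rightarrow> complex" and M :: "'k \<Rightarrow> 'a::topological_space measure"
  assumes finite_K: "finite K"
    and sets_M: "k \<in> K \<Longrightarrow> sets (M k) = sets borel"
    and finite_M: "k \<in> K \<Longrightarrow> finite_measure (M k)"
begin

definition charge :: "'a set \<Rightarrow> complex" where
  "charge \<alpha> = (\<Sum>k\<in>K. c k * complex_of_real (measure (M k) \<alpha>))"

definition functional :: "('a \<Rightarrow> complex) \<Rightarrow> complex" where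
  "functional f = (\<Sum>k\<in>K. c k * (LINT t|M k. f t))"

lemma space_M: "k \<in> K \<Longrightarrow> space (M k) = UNIV"
  using sets_eq_imp_space_eq[OF sets_M] by simp

lemma measurable_M: "k \<in> K \<Longrightarrow> f \<in> borel_measurable borel \<Longrightarrow> f \<in> borel_measurable (M k)"
  using measurable_cong_sets[OF sets_M refl] by blast

lemma integrable_bounded:
  fixes f :: "'a \<Rightarrow> 'b::{banach, second_countable_topology}"
  assumes "k \<in> K" "f \<in> borel_measurable borel" "\<And>t. norm (f t) \<le> B"
  shows "integrable (M k) f"
  using assms by (intro finite_measure.integrable_const_bound[OF finite_M, of k f B] measurable_M) auto

lemma integral_step:
  assumes "k \<in> K" "finite P" "P \<subseteq> sets borel"
  shows "(LINT t|M k. (\<Sum>\<alpha>\<in>P. v \<alpha> * indicator \<alpha> t)) =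
    (\<Sum>\<alpha>\<in>P. v \<alpha> * complex_of_real (measure (M k) \<alpha>))"
proof -
  interpret finite_measure "M k" by (rule finite_M[OF assms(1)])
  have "integrable (M k) (\<lambda>t. indicator \<alpha> t :: complex)" if "\<alpha> \<in> P" for \<alpha>
    using that assms
    by (intro integrable_bounded[OF assms(1), of _ 1] borel_measurable_indicator)
      (auto simp: indicator_def)
  then have "(LINT t|M k. (\<Sum>\<alpha>\<in>P. v \<alpha> * indicator \<alpha> t)) =
      (\<Sum>\<alpha>\<in>P. v \<alpha> * (LINT t|M k. indicator \<alpha> t))"
    by (simp add: Bochner_Integration.integral_sum)
  also have "\<dots> = (\<Sum>\<alpha>\<in>P. v \<alpha> * complex_of_real (measure (M k) \<alpha>))"
  proof (rule sum.cong[OF refl])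
    fix \<alpha> assume "\<alpha> \<in> P"
    have "(LINT t|M k. indicator \<alpha> t :: complex) =
        (LINT t|M k. complex_of_real (indicat_real \<alpha> t))"
      by (rule Bochner_Integration.integral_cong) (simp_all add: indicator_def)
    also have "\<dots> = complex_of_real (measure (M k) \<alpha>)"
      using assms(1) by (simp add: space_M)
    finally have "(LINT t|M k. indicator \<alpha> t :: complex) = complex_of_real (measure (M k) \<alpha>)" .
    then show "v \<alpha> * (LINT t|M k. indicator \<alpha> t) = v \<alpha> * complex_of_real (measure (M k) \<alpha>)"
      by simp
  qed
  finally show ?thesis .
qed

lemma functional_step:
  assumes "finite P" "P \<subseteq> sets borel"
  shows "functional (\<lambda>t. \<Sum>\<alpha>\<in>P. v \<alpha> * indicator \<alpha> t) = (\<Sum>\<alpha>\<in>P. v \<alpha> * charge \<alpha>)"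
proof -
  have "functional (\<lambda>t. \<Sum>\<alpha>\<in>P. v \<alpha> * indicator \<alpha> t) =
      (\<Sum>k\<in>K. \<Sum>\<alpha>\<in>P. v \<alpha> * (c k * complex_of_real (measure (M k) \<alpha>)))"
    unfolding functional_def
    by (rule sum.cong[OF refl]) (simp only: integral_step assms sum_distrib_left mult_ac)
  also have "\<dots> = (\<Sum>\<alpha>\<in>P. \<Sum>k\<in>K. v \<alpha> * (c k * complex_of_real (measure (M k) \<alpha>)))"
    by (rule sum.swap)
  finally show ?thesis by (simp add: charge_def sum_distrib_left)
qed

text \<open>The bounds \<open>d k\<close> are on \<open>L\<^sup>1\<close> distances, because both approximation arguments below, by step
  functions and by continuous functions, come down to these.\<close>

lemma functional_diff_le:
  assumes "f \<in> borel_measurable borel" "\<And>t. cmod (f t) \<le> B"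
    and "g \<in> borel_measurable borel" "\<And>t. cmod (g t) \<le> C"
    and "\<And>k. k \<in> K \<Longrightarrow> (LINT t|M k. cmod (f t - g t)) \<le> d k"
  shows "cmod (functional f - functional g) \<le> (\<Sum>k\<in>K. cmod (c k) * d k)"
proof -
  have "functional f - functional g = (\<Sum>k\<in>K. c k * (LINT t|M k. f t - g t))"
    using integrable_bounded[OF _ assms(1,2)] integrable_bounded[OF _ assms(3,4)]
    by (simp add: functional_def sum_subtractf right_diff_distrib)
  also have "cmod \<dots> \<le> (\<Sum>k\<in>K. cmod (c k) * d k)"
  proof (rule sum_norm_le)
    fix k assume "k \<in> K"
    have "cmod (LINT t|M k. f t - g t) \<le> d k"
      using assms(5)[OF \<open>k \<in> K\<close>] by (rule order_trans[OF integral_norm_bound])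
    then show "cmod (c k * (LINT t|M k. f t - g t)) \<le> cmod (c k) * d k"
      by (simp add: norm_mult mult_left_mono)
  qed
  finally show ?thesis .
qed

lemma step_measurable:
  assumes "P \<subseteq> sets borel"
  shows "(\<lambda>t. \<Sum>\<alpha>\<in>P. v \<alpha> * indicator \<alpha> t :: complex) \<in> borel_measurable borel"
  using assms by (intro borel_measurable_sum borel_measurable_times borel_measurable_const
    borel_measurable_indicator) auto

lemma step_eq:
  assumes "finite P" "partition_on UNIV P" "\<beta> \<in> P" "t \<in> \<beta>"
  shows "(\<Sum>\<alpha>\<in>P. v \<alpha> * indicator \<alpha> t :: complex) = v \<beta>"
proof -
  have "(\<Sum>\<alpha>\<in>P. v \<alpha> * indicator \<alpha> t :: complex) = (\<Sum>\<alpha>\<in>P. if \<alpha> = \<beta> then v \<alpha> else 0)"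
  proof (rule sum.cong[OF refl])
    fix \<alpha> assume "\<alpha> \<in> P"
    have "disjoint P" using assms(2) by (simp add: partition_on_def)
    then have "\<alpha> = \<beta> \<longleftrightarrow> t \<in> \<alpha>"
      using \<open>\<alpha> \<in> P\<close> assms(3,4) by (auto simp: pairwise_def disjnt_def)
    then show "v \<alpha> * indicator \<alpha> t = (if \<alpha> = \<beta> then v \<alpha> else 0)"
      by (simp add: indicator_def)
  qed
  then show ?thesis using assms by simp
qed

lemma step_bound:
  assumes "finite P" "partition_on UNIV P" "\<And>\<alpha>. \<alpha> \<in> P \<Longrightarrow> cmod (v \<alpha>) \<le> B"
  shows "cmod (\<Sum>\<alpha>\<in>P. v \<alpha> * indicator \<alpha> t :: complex) \<le> B"
proof -
  have "t \<in> \<Union>P" using assms(2) by (simp add: partition_on_def)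
  then obtain \<beta> where "\<beta> \<in> P" "t \<in> \<beta>" by blast
  then show ?thesis using assms step_eq by metis
qed

text \<open>The error involves only the total masses and not the partition, hence it is uniform over any
  family of combinations of bounded mass.\<close>

lemma functional_step_sum:
  assumes f: "f \<in> borel_measurable borel" "\<And>t. cmod (f t) \<le> B"
    and P: "fine_partition f \<epsilon> P"
  shows "cmod (functional f - step_sum f P charge) \<le>
    \<epsilon> * (\<Sum>k\<in>K. cmod (c k) * measure (M k) UNIV)"
proof -
  have fin: "finite P" and part: "partition_on UNIV P" and meas: "P \<subseteq> sets borel"
    and osc: "\<And>\<alpha> s t. \<alpha> \<in> P \<Longrightarrow> s \<in> \<alpha> \<Longrightarrow> t \<in> \<alpha> \<Longrightarrow> cmod (f s - f t) \<le> \<epsilon>"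
    using P by (auto simp: fine_partition_def)
  define g where "g t = (\<Sum>\<alpha>\<in>P. f (SOME t. t \<in> \<alpha>) * indicator \<alpha> t)" for t
  have g: "g \<in> borel_measurable borel" "cmod (g t) \<le> B" for t
    unfolding g_def using step_measurable[OF meas] step_bound[OF fin part] f(2) by auto
  have close: "cmod (f t - g t) \<le> \<epsilon>" for t
  proof -
    have "t \<in> \<Union>P" using part by (simp add: partition_on_def)
    then obtain \<beta> where \<beta>: "\<beta> \<in> P" "t \<in> \<beta>" by blast
    have "(SOME t. t \<in> \<beta>) \<in> \<beta>" using \<beta>(2) by (rule someI)
    then show ?thesis using osc[OF \<beta>(1,2)] step_eq[OF fin part \<beta>] by (simp add: g_def)
  qed
  have "(LINT t|M k. cmod (f t - g t)) \<le> \<epsilon> * measure (M k) UNIV" if "k \<in> K" for k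
  proof -
    interpret finite_measure "M k" by (rule finite_M[OF that])
    have "(LINT t|M k. cmod (f t - g t)) \<le> (LINT t|M k. \<epsilon>)"
    proof (rule integral_mono)
      show "integrable (M k) (\<lambda>t. cmod (f t - g t))"
        using close f(1) g(1) by (intro integrable_bounded[OF that, of _ \<epsilon>]) auto
    qed (simp_all add: close)
    then show ?thesis using that by (simp add: space_M mult.commute)
  qed
  from functional_diff_le[OF f g this]
  have "cmod (functional f - functional g) \<le> (\<Sum>k\<in>K. cmod (c k) * (\<epsilon> * measure (M k) UNIV))" .
  moreover have "functional g = step_sum f P charge"
    unfolding g_def step_sum_def by (rule functional_step[OF fin meas])
  ultimately show ?thesis by (simp add: sum_distrib_left mult_ac)
qed

text \<open>A Riemann sum with values of modulus at most \<open>B\<close> is at most \<open>B\<close> times the sum of the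
  \<open>|\<mu>(\<alpha>)|\<close> over the partition.  In particular the functional vanishes if the charge does, so it
  depends on the charge alone.\<close>

lemma functional_le_variation:
  assumes f: "f \<in> borel_measurable borel" "\<And>t. cmod (f t) \<le> B"
    and v: "\<And>P. finite P \<Longrightarrow> partition_on UNIV P \<Longrightarrow> P \<subseteq> sets borel \<Longrightarrow>
      (\<Sum>\<alpha>\<in>P. cmod (charge \<alpha>)) \<le> v"
  shows "cmod (functional f) \<le> B * v"
proof -
  define C where "C = (\<Sum>k\<in>K. cmod (c k) * measure (M k) UNIV)"
  have "C \<ge> 0" unfolding C_def by (intro sum_nonneg) simp
  have "0 \<le> B" using f(2)[of undefined] norm_ge_zero order_trans by blast
  show ?thesis
  proof (rule field_le_epsilon)
    fix e :: real assume "e > 0"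
    define \<epsilon> where "\<epsilon> = e / (C + 1)"
    have "\<epsilon> > 0" "\<epsilon> * C \<le> e" using \<open>e > 0\<close> \<open>C \<ge> 0\<close> by (auto simp: \<epsilon>_def field_simps)
    obtain P where P: "fine_partition f \<epsilon> P" using ex_fine_partition[OF f \<open>\<epsilon> > 0\<close>] by blast
    have "cmod (step_sum f P charge) \<le> (\<Sum>\<alpha>\<in>P. B * cmod (charge \<alpha>))"
      unfolding step_sum_def by (intro sum_norm_le) (simp add: norm_mult mult_right_mono f(2))
    also have "\<dots> \<le> B * v"
      using P v[of P] \<open>0 \<le> B\<close>
      by (auto simp: sum_distrib_left[symmetric] fine_partition_def intro: mult_left_mono)
    finally have "cmod (step_sum f P charge) \<le> B * v" .
    moreover have "cmod (functional f - step_sum f P charge) \<le> e"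
      using functional_step_sum[OF f P] \<open>\<epsilon> * C \<le> e\<close> by (simp add: C_def)
    ultimately show "cmod (functional f) \<le> B * v + e"
      using norm_triangle_sub[of "functional f" "step_sum f P charge"] by linarith
  qed
qed


lemma functional_le_mass:
  assumes f: "f \<in> borel_measurable borel" "\<And>t. cmod (f t) \<le> B"
  shows "cmod (functional f) \<le> B * (\<Sum>k\<in>K. cmod (c k) * measure (M k) UNIV)"
proof (rule functional_le_variation[OF f])
  fix P :: "'a set set"
  assume P: "finite P" "partition_on UNIV P" "P \<subseteq> sets borel"
  have mass: "(\<Sum>\<alpha>\<in>P. measure (M k) \<alpha>) = measure (M k) UNIV" if k: "k \<in> K" for k
  proof -
    interpret finite_measure "M k" by (rule finite_M[OF k])
    have "disjoint_family_on (\<lambda>\<alpha>. \<alpha>) P"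
      using P(2) by (auto simp: partition_on_def disjoint_family_on_def pairwise_def disjnt_def)
    then have "measure (M k) (\<Union>P) = (\<Sum>\<alpha>\<in>P. measure (M k) \<alpha>)"
      using finite_measure_finite_Union[of P "\<lambda>\<alpha>. \<alpha>"] P sets_M[OF k] by simp
    then show ?thesis using P(2) by (simp add: partition_on_def)
  qed
  have "(\<Sum>\<alpha>\<in>P. cmod (charge \<alpha>)) \<le> (\<Sum>\<alpha>\<in>P. \<Sum>k\<in>K. cmod (c k) * measure (M k) \<alpha>)"
    unfolding charge_def by (intro sum_mono sum_norm_le) (simp add: norm_mult)
  also have "\<dots> = (\<Sum>k\<in>K. \<Sum>\<alpha>\<in>P. cmod (c k) * measure (M k) \<alpha>)" by (rule sum.swap)
  also have "\<dots> = (\<Sum>k\<in>K. cmod (c k) * measure (M k) UNIV)"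
    by (simp add: sum_distrib_left[symmetric] mass)
  finally show "(\<Sum>\<alpha>\<in>P. cmod (charge \<alpha>)) \<le> (\<Sum>k\<in>K. cmod (c k) * measure (M k) UNIV)" .
qed

section \<open>Approximation by continuous functions\<close>

text \<open>Membership in the \<open>L\<^sup>1\<close> closure of the bounded continuous functions, simultaneously for the
  finitely many measures \<open>M k\<close>.  The approximants need not respect the bound of the function that they
  approximate; the sup norm is restored once, at the end, by a retraction onto the unit disc.\<close>

definition approximable :: "('a \<Rightarrow> complex) \<Rightarrow> bool" where
  "approximable g \<longleftrightarrow> g \<in> borel_measurable borel \<and> bounded (range g) \<and>
     (\<forall>\<epsilon>>0. \<exists>f. continuous_on UNIV f \<and> bounded (range f) \<and>
       (\<forall>k\<in>K. (LINT t|M k. cmod (f t - g t)) < \<epsilon>))"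

lemma approximableE:
  assumes "approximable g" "\<epsilon> > 0"
  obtains f where "continuous_on UNIV f" "f \<in> borel_measurable borel" "bounded (range f)"
    "\<And>k. k \<in> K \<Longrightarrow> (LINT t|M k. cmod (f t - g t)) < \<epsilon>"
  using assms borel_measurable_continuous_onI unfolding approximable_def by metis

lemma approximableD:
  assumes "approximable g"
  shows "g \<in> borel_measurable borel" "bounded (range g)"
  using assms by (auto simp: approximable_def)

lemma integrable_dist:
  assumes "k \<in> K" "f \<in> borel_measurable borel" "bounded (range f)"
    "g \<in> borel_measurable borel" "bounded (range g)"
  shows "integrable (M k) (\<lambda>t. cmod (f t - g t))"
proof -
  obtain B C where "\<And>t. cmod (f t) \<le> B" "\<And>t. cmod (g t) \<le> C"
    using assms(3,5) by (auto simp: bounded_iff)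
  then have "norm (cmod (f t - g t)) \<le> B + C" for t
    using norm_triangle_le_diff[of "f t" "g t" "B + C"] add_mono[of "cmod (f t)" B "cmod (g t)" C]
    by simp
  then show ?thesis using assms by (intro integrable_bounded[of k _ "B + C"]) auto
qed

lemma approximable_continuous:
  assumes "continuous_on UNIV g" "bounded (range g)"
  shows "approximable g"
  using assms borel_measurable_continuous_onI[OF assms(1)]
  unfolding approximable_def by (intro conjI allI impI exI[of _ g]) auto

lemma approximable_add:
  assumes "approximable g" "approximable h"
  shows "approximable (\<lambda>t. g t + h t)"
  unfolding approximable_def
proof (intro conjI allI impI)
  note g = approximableD[OF assms(1)] and h = approximableD[OF assms(2)]
  show "(\<lambda>t. g t + h t) \<in> borel_measurable borel" using g h by simp
  show "bounded (range (\<lambda>t. g t + h t))" using g h by (intro bounded_plus_comp)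
  fix \<epsilon> :: real assume "\<epsilon> > 0"
  then have "\<epsilon> / 2 > 0" by simp
  obtain u where u: "continuous_on UNIV u" "u \<in> borel_measurable borel" "bounded (range u)"
    "\<And>k. k \<in> K \<Longrightarrow> (LINT t|M k. cmod (u t - g t)) < \<epsilon> / 2"
    by (rule approximableE[OF assms(1) \<open>\<epsilon> / 2 > 0\<close>]) blast
  obtain v where v: "continuous_on UNIV v" "v \<in> borel_measurable borel" "bounded (range v)"
    "\<And>k. k \<in> K \<Longrightarrow> (LINT t|M k. cmod (v t - h t)) < \<epsilon> / 2"
    by (rule approximableE[OF assms(2) \<open>\<epsilon> / 2 > 0\<close>]) blast
  have "(LINT t|M k. cmod ((u t + v t) - (g t + h t))) < \<epsilon>" if k: "k \<in> K" for k
  proof -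
    have "(LINT t|M k. cmod ((u t + v t) - (g t + h t))) \<le>
        (LINT t|M k. cmod (u t - g t) + cmod (v t - h t))"
    proof (rule integral_mono)
      show "integrable (M k) (\<lambda>t. cmod ((u t + v t) - (g t + h t)))"
        using g h u v by (intro integrable_dist k bounded_plus_comp) auto
      show "integrable (M k) (\<lambda>t. cmod (u t - g t) + cmod (v t - h t))"
        using g h u v by (intro Bochner_Integration.integrable_add integrable_dist k)
    qed (rule norm_diff_triangle_ineq)
    also have "\<dots> = (LINT t|M k. cmod (u t - g t)) + (LINT t|M k. cmod (v t - h t))"
      using g h u v by (intro Bochner_Integration.integral_add integrable_dist k)
    finally show ?thesis using u(4)[OF k] v(4)[OF k] by linarith
  qed
  moreover have "continuous_on UNIV (\<lambda>t. u t + v t)" "bounded (range (\<lambda>t. u t + v t))"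
    using u v by (auto intro: continuous_on_add bounded_plus_comp)
  ultimately show "\<exists>f. continuous_on UNIV f \<and> bounded (range f) \<and>
      (\<forall>k\<in>K. (LINT t|M k. cmod (f t - (g t + h t))) < \<epsilon>)"
    by (intro exI[of _ "\<lambda>t. u t + v t"]) auto
qed

lemma approximable_mult:
  assumes "approximable g"
  shows "approximable (\<lambda>t. a * g t)"
  unfolding approximable_def
proof (intro conjI allI impI)
  note g = approximableD[OF assms]
  show "(\<lambda>t. a * g t) \<in> borel_measurable borel" using g by simp
  have bdd: "bounded (range (\<lambda>t. a * u t))" if "bounded (range u)" for u :: "'a \<Rightarrow> complex"
    using bounded_linear_image[OF that bounded_linear_mult_right[of a]] by (simp add: image_image)
  then show "bounded (range (\<lambda>t. a * g t))" using g by simp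
  fix \<epsilon> :: real assume "\<epsilon> > 0"
  then have "\<epsilon> / (cmod a + 1) > 0" by (simp add: add_nonneg_pos)
  obtain u where u: "continuous_on UNIV u" "u \<in> borel_measurable borel" "bounded (range u)"
    "\<And>k. k \<in> K \<Longrightarrow> (LINT t|M k. cmod (u t - g t)) < \<epsilon> / (cmod a + 1)"
    by (rule approximableE[OF assms \<open>\<epsilon> / (cmod a + 1) > 0\<close>]) blast
  have "(LINT t|M k. cmod (a * u t - a * g t)) < \<epsilon>" if k: "k \<in> K" for k
  proof -
    let ?I = "LINT t|M k. cmod (u t - g t)"
    have "(LINT t|M k. cmod (a * u t - a * g t)) = cmod a * ?I"
      by (simp add: right_diff_distrib[symmetric] norm_mult)
    also have "\<dots> \<le> (cmod a + 1) * ?I" by (intro mult_right_mono) simp_all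
    also have "\<dots> < \<epsilon>"
      using u(4)[OF k] pos_less_divide_eq[of "cmod a + 1" ?I \<epsilon>]
      by (simp add: add_nonneg_pos mult.commute)
    finally show ?thesis .
  qed
  then show "\<exists>f. continuous_on UNIV f \<and> bounded (range f) \<and>
      (\<forall>k\<in>K. (LINT t|M k. cmod (f t - a * g t)) < \<epsilon>)"
    using u(1,3) bdd by (intro exI[of _ "\<lambda>t. a * u t"]) (auto intro: continuous_on_mult_left)
qed

lemma approximable_sum:
  assumes "\<And>i. i \<in> I \<Longrightarrow> approximable (g i)"
  shows "approximable (\<lambda>t. \<Sum>i\<in>I. g i t)"
  using assms
  by (induction I rule: infinite_finite_induct)
    (simp_all add: approximable_add approximable_continuous)

text \<open>By dominated convergence, a bounded pointwise limit is an \<open>L\<^sup>1\<close> limit for each of the finitely many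
  measures, so one index \<open>n\<close> serves all of them.\<close>

lemma approximable_limit:
  assumes g: "\<And>n. approximable (g n)"
    and bound: "\<And>n t. cmod (g n t) \<le> B"
    and lim: "\<And>t. (\<lambda>n. g n t) \<longlonglongrightarrow> h t"
  shows "approximable h"
  unfolding approximable_def
proof (intro conjI allI impI)
  note g' = approximableD[OF g]
  show h: "h \<in> borel_measurable borel"
    by (rule borel_measurable_LIMSEQ_metric[OF g'(1) lim])
  have hB: "cmod (h t) \<le> B" for t
    by (rule LIMSEQ_le_const2[OF tendsto_norm[OF lim]]) (use bound in auto)
  then show bdd: "bounded (range h)" by (auto simp: bounded_iff)
  fix \<epsilon> :: real assume "\<epsilon> > 0"
  then have "\<epsilon> / 2 > 0" by simp
  have "(\<lambda>n. LINT t|M k. cmod (g n t - h t)) \<longlonglongrightarrow> 0" if k: "k \<in> K" for k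
  proof -
    interpret finite_measure "M k" by (rule finite_M[OF k])
    have "(\<lambda>n. LINT t|M k. cmod (g n t - h t)) \<longlonglongrightarrow> (LINT t|M k. 0)"
    proof (rule integral_dominated_convergence)
      show "(\<lambda>t. cmod (g n t - h t)) \<in> borel_measurable (M k)" for n
        using g'(1)[of n] h by (intro measurable_M k) simp
      show "AE t in M k. (\<lambda>n. cmod (g n t - h t)) \<longlonglongrightarrow> 0"
        using lim by (auto simp: tendsto_norm_zero_iff LIM_zero_iff)
      have "cmod (g n t - h t) \<le> B + B" for n t
        using norm_triangle_ineq4[of "g n t" "h t"] bound[of n t] hB[of t] by linarith
      then show "AE t in M k. norm (cmod (g n t - h t)) \<le> B + B" for n by simp
    qed simp_all
    then show ?thesis by simp
  qed
  then have "\<forall>k\<in>K. \<forall>\<^sub>F n in sequentially. (LINT t|M k. cmod (g n t - h t)) < \<epsilon> / 2"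
    using \<open>\<epsilon> / 2 > 0\<close> by (intro ballI order_tendstoD(2)) blast
  then have "\<forall>\<^sub>F n in sequentially. \<forall>k\<in>K. (LINT t|M k. cmod (g n t - h t)) < \<epsilon> / 2"
    using finite_K by (simp add: eventually_ball_finite)
  then obtain n where n: "\<And>k. k \<in> K \<Longrightarrow> (LINT t|M k. cmod (g n t - h t)) < \<epsilon> / 2"
    by (auto simp: eventually_sequentially)
  obtain u where u: "continuous_on UNIV u" "u \<in> borel_measurable borel" "bounded (range u)"
    "\<And>k. k \<in> K \<Longrightarrow> (LINT t|M k. cmod (u t - g n t)) < \<epsilon> / 2"
    by (rule approximableE[OF g \<open>\<epsilon> / 2 > 0\<close>]) blast
  have "(LINT t|M k. cmod (u t - h t)) < \<epsilon>" if k: "k \<in> K" for k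
  proof -
    have "(LINT t|M k. cmod (u t - h t)) \<le>
        (LINT t|M k. cmod (u t - g n t) + cmod (g n t - h t))"
    proof (rule integral_mono)
      show "integrable (M k) (\<lambda>t. cmod (u t - g n t) + cmod (g n t - h t))"
        using g' u h bdd by (intro Bochner_Integration.integrable_add integrable_dist k)
      show "cmod (u t - h t) \<le> cmod (u t - g n t) + cmod (g n t - h t)" for t
        using norm_triangle_ineq[of "u t - g n t" "g n t - h t"] by simp
    qed (intro integrable_dist k u h bdd)
    also have "\<dots> = (LINT t|M k. cmod (u t - g n t)) + (LINT t|M k. cmod (g n t - h t))"
      using g' u h bdd by (intro Bochner_Integration.integral_add integrable_dist k)
    finally show ?thesis using u(4)[OF k] n[OF k] by linarith
  qed
  then show "\<exists>f. continuous_on UNIV f \<and> bounded (range f) \<and>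
      (\<forall>k\<in>K. (LINT t|M k. cmod (f t - h t)) < \<epsilon>)"
    using u(1,3) by (intro exI[of _ u]) auto
qed

end

lemma compact_Urysohn_point:
  fixes U :: "'a::t2_space set"
  assumes "compact (UNIV :: 'a set)" "open U" "x \<in> U"
  obtains g :: "'a \<Rightarrow> real" where "continuous_on UNIV g" "\<And>t. 0 \<le> g t" "g x = 1"
    "\<And>t. t \<notin> U \<Longrightarrow> g t = 0"
proof -
  have "Hausdorff_space (euclidean :: 'a topology)"
    unfolding Hausdorff_space_def by (simp add: disjnt_def) (metis hausdorff)
  then have "normal_space (euclidean :: 'a topology)"
    using assms(1) by (intro compact_Hausdorff_or_regular_imp_normal_space)
      (auto simp: compact_space_def)
  moreover have "closedin euclidean {x}" "closedin euclidean (- U)" "disjnt {x} (- U)"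
    using assms(2,3) by (auto simp: disjnt_def)
  ultimately obtain f where f: "continuous_map euclidean euclideanreal f"
      "f ` {x} \<subseteq> {1}" "f ` (- U) \<subseteq> {0}"
    by (rule Urysohn_lemma_alt)
  have "continuous_on UNIV (\<lambda>t. \<bar>f t\<bar>)"
    using f(1) by (intro continuous_intros) (simp add: continuous_map_iff_continuous2)
  with f that[of "\<lambda>t. \<bar>f t\<bar>"] show ?thesis by (auto simp: image_subset_iff)
qed

text \<open>Each point of \<open>U\<close> has a Urysohn function that is positive there and vanishes off \<open>U\<close>; by second countability, countably many of these have no common
  zero in \<open>U\<close>, and the truncated multiples of their partial sums increase to the indicator of \<open>U\<close>.\<close>

lemma indicator_open_limit_continuous:
  fixes U :: "'a::{t2_space, second_countable_topology} set"
  assumes "compact (UNIV :: 'a set)" "open U"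
  obtains f :: "nat \<Rightarrow> 'a \<Rightarrow> real" where "\<And>n. continuous_on UNIV (f n)"
    "\<And>n t. 0 \<le> f n t" "\<And>n t. f n t \<le> 1" "\<And>t. (\<lambda>n. f n t) \<longlonglongrightarrow> indicator U t"
proof -
  have "\<forall>x\<in>U. \<exists>g :: 'a \<Rightarrow> real. continuous_on UNIV g \<and> (\<forall>t. 0 \<le> g t) \<and> g x = 1 \<and>
      (\<forall>t. t \<notin> U \<longrightarrow> g t = 0)"
    using compact_Urysohn_point[OF assms] by metis
  then obtain g :: "'a \<Rightarrow> 'a \<Rightarrow> real" where g: "\<And>x. x \<in> U \<Longrightarrow> continuous_on UNIV (g x)"
      "\<And>x t. x \<in> U \<Longrightarrow> 0 \<le> g x t" "\<And>x. x \<in> U \<Longrightarrow> g x x = 1"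
      "\<And>x t. x \<in> U \<Longrightarrow> t \<notin> U \<Longrightarrow> g x t = 0"
    by metis
  let ?S = "\<lambda>x. {t. g x t > 0}"
  have "open S" if "S \<in> ?S ` U" for S
    using that g(1) by (auto intro!: open_Collect_less continuous_on_const)
  then obtain \<F> where \<F>: "\<F> \<subseteq> ?S ` U" "countable \<F>" "\<Union>\<F> = \<Union>(?S ` U)"
    by (rule Lindelof)
  then obtain C where C: "C \<subseteq> U" "countable C" "\<F> = ?S ` C"
    by (metis countable_image_eq countable_subset_image)
  show ?thesis
  proof (cases "U = {}")
    case True
    then show ?thesis using that[of "\<lambda>n t. 0"] by simp
  next
    case False
    have cover: "\<exists>x\<in>C. g x t > 0" if "t \<in> U" for t
    proof -
      have "t \<in> \<Union>(?S ` U)" using that g(3)[OF that] by force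
      then show ?thesis using \<F>(3) C(3) by auto
    qed
    with False have "C \<noteq> {}" by blast
    define h where "h i = g (from_nat_into C i)" for i
    have h_in: "from_nat_into C i \<in> U" for i
      using from_nat_into[OF \<open>C \<noteq> {}\<close>] C(1) by blast
    define f where "f n t = min 1 (real n * (\<Sum>i<n. h i t))" for n t
    show ?thesis
    proof
      show "continuous_on UNIV (f n)" for n
        unfolding f_def h_def using g(1)[OF h_in]
        by (intro continuous_on_min continuous_on_const continuous_on_mult continuous_on_sum)
      have h_nonneg: "0 \<le> h i t" for i t unfolding h_def by (rule g(2)[OF h_in])
      then show "0 \<le> f n t" for n t by (simp add: f_def sum_nonneg)
      show "f n t \<le> 1" for n t by (simp add: f_def)
      show "(\<lambda>n. f n t) \<longlonglongrightarrow> indicator U t" for t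
      proof (cases "t \<in> U")
        case False
        then have "f n t = 0" for n by (simp add: f_def h_def g(4)[OF h_in])
        then show ?thesis using False by simp
      next
        case True
        obtain x where x: "x \<in> C" "g x t > 0" using cover[OF True] by blast
        obtain i where i: "from_nat_into C i = x"
          using from_nat_into_surj[OF C(2) x(1)] by blast
        then have pos: "h i t > 0" using x by (simp add: h_def)
        obtain N where N: "real N * h i t \<ge> 1"
          using reals_Archimedean3[OF pos] by (metis less_eq_real_def)
        have "f n t = 1" if "n \<ge> max N (Suc i)" for n
        proof -
          have "h i t \<le> (\<Sum>i<n. h i t)" using that h_nonneg by (intro member_le_sum) auto
          moreover have "real N \<le> real n" using that by simp
          ultimately have "real N * h i t \<le> real n * (\<Sum>i<n. h i t)"
            using h_nonneg by (intro mult_mono) auto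
          then show ?thesis using N by (simp add: f_def)
        qed
        then have "\<forall>\<^sub>F n in sequentially. f n t = 1"
          unfolding eventually_sequentially by blast
        then show ?thesis using True by (simp add: tendsto_eventually)
      qed
    qed
  qed
qed

locale compact_measure_combination = measure_combination K c M
  for K :: "'k set" and c :: "'k \<Rightarrow> complex"
    and M :: "'k \<Rightarrow> 'a::{t2_space, second_countable_topology} measure" +
  assumes compact_UNIV: "compact (UNIV :: 'a set)"
begin

text \<open>The sets whose indicator is approximable form a Dynkin system that contains the open sets.  This
  replaces the regularity of finite Borel measures on \<open>A\<close>.\<close>

lemma approximable_indicator:
  assumes "\<alpha> \<in> sets (borel :: 'a measure)"
  shows "approximable (indicator \<alpha>)"
proof -
  have "Int_stable {S :: 'a set. open S}" by (auto simp: Int_stable_def)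
  moreover have "{S :: 'a set. open S} \<subseteq> Pow UNIV" by simp
  moreover have "\<alpha> \<in> sigma_sets UNIV {S :: 'a set. open S}"
    using assms by (simp add: borel_def)
  ultimately show ?thesis
  proof (induction \<alpha> rule: sigma_sets_induct_disjoint)
    case (basic U)
    then have "open U" by simp
    obtain f :: "nat \<Rightarrow> 'a \<Rightarrow> real" where f: "\<And>n. continuous_on UNIV (f n)"
      "\<And>n t. 0 \<le> f n t" "\<And>n t. f n t \<le> 1" "\<And>t. (\<lambda>n. f n t) \<longlonglongrightarrow> indicator U t"
      by (rule indicator_open_limit_continuous[OF compact_UNIV \<open>open U\<close>]) blast
    show ?case
    proof (rule approximable_limit)
      show bound: "cmod (complex_of_real (f n t)) \<le> 1" for n t using f by simp
      then show "approximable (\<lambda>t. complex_of_real (f n t))" for n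
        using f(1) by (intro approximable_continuous continuous_on_of_real)
          (auto simp: bounded_iff)
      have "(\<lambda>n. complex_of_real (f n t)) \<longlonglongrightarrow> complex_of_real (indicator U t)" for t
        by (intro tendsto_of_real f)
      then show "(\<lambda>n. complex_of_real (f n t)) \<longlonglongrightarrow> indicator U t" for t
        by (simp add: of_real_indicator)
    qed
  next
    case empty
    then show ?case by (auto intro!: approximable_continuous)
  next
    case (compl \<alpha>)
    have "approximable (\<lambda>t. 1 + (-1) * indicator \<alpha> t)"
      by (intro approximable_add approximable_mult compl) (simp add: approximable_continuous)
    moreover have "(\<lambda>t. 1 + (-1) * indicator \<alpha> t) = (indicator (UNIV - \<alpha>) :: 'a \<Rightarrow> complex)"
      by (auto simp: indicator_def)
    ultimately show ?case by simp
  next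
    case (union \<delta>)
    have part: "(\<Sum>i<n. indicator (\<delta> i) t) = (indicator (\<Union>i<n. \<delta> i) t :: complex)" for n t
      using union(1) by (intro indicator_UN_disjoint[symmetric])
        (auto simp: disjoint_family_on_def)
    show ?case
    proof (rule approximable_limit)
      show "approximable (\<lambda>t. \<Sum>i<n. indicator (\<delta> i) t)" for n
        by (intro approximable_sum union)
      show "cmod (\<Sum>i<n. indicator (\<delta> i) t) \<le> 1" for n t
        unfolding part by (simp add: indicator_def)
      show "(\<lambda>n. \<Sum>i<n. indicator (\<delta> i) t :: complex) \<longlonglongrightarrow> indicator (\<Union>i. \<delta> i) t" for t
        by (simp only: part LIMSEQ_indicator_UN)
    qed
  qed
qed

text \<open>The converse of the bound by the variation: the functional attains \<open>\<Sum>|\<mu>(\<alpha>)|\<close> at a step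
  function of modulus at most one, which is an \<open>L\<^sup>1\<close> limit of continuous functions of modulus at most
  one.\<close>

lemma variation_le_dual_norm:
  assumes P: "finite P" "partition_on UNIV P" "P \<subseteq> sets borel"
    and v: "\<And>f. continuous_on UNIV f \<Longrightarrow> (\<And>t. cmod (f t) \<le> 1) \<Longrightarrow> cmod (functional f) \<le> v"
  shows "(\<Sum>\<alpha>\<in>P. cmod (charge \<alpha>)) \<le> v"
proof -
  \<comment> \<open>The step function \<open>g\<close> undoes the phases of the charges.\<close>
  define u where "u \<alpha> = cnj (sgn (charge \<alpha>))" for \<alpha>
  define g where "g t = (\<Sum>\<alpha>\<in>P. u \<alpha> * indicator \<alpha> t)" for t
  have phase: "u \<alpha> * charge \<alpha> = complex_of_real (cmod (charge \<alpha>))" for \<alpha>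
    by (simp add: u_def sgn_eq complex_norm_square[symmetric] mult.commute[of "cnj _"]
        power2_eq_square)
  have "cmod (u \<alpha>) \<le> 1" for \<alpha> by (simp add: u_def norm_sgn)
  then have g_le: "cmod (g t) \<le> 1" for t unfolding g_def by (rule step_bound[OF P(1,2)])
  have "functional g = complex_of_real (\<Sum>\<alpha>\<in>P. cmod (charge \<alpha>))"
    unfolding g_def functional_step[OF P(1,3)] by (simp add: phase)
  then have Fg: "cmod (functional g) = (\<Sum>\<alpha>\<in>P. cmod (charge \<alpha>))"
    by (simp add: sum_nonneg del: of_real_sum)
  have g: "approximable g"
    unfolding g_def using P(3)
    by (intro approximable_sum approximable_mult approximable_indicator) auto
  let ?r = "closest_point (cball (0::complex) 1)"
  show ?thesis
  proof (rule field_le_epsilon)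
    fix e :: real assume "e > 0"
    define C where "C = (\<Sum>k\<in>K. cmod (c k))"
    have "C \<ge> 0" by (simp add: C_def sum_nonneg)
    define \<epsilon> where "\<epsilon> = e / (C + 1)"
    have "\<epsilon> > 0" "C * \<epsilon> \<le> e" using \<open>e > 0\<close> \<open>C \<ge> 0\<close> by (auto simp: \<epsilon>_def field_simps)
    obtain f where f: "continuous_on UNIV f" "f \<in> borel_measurable borel" "bounded (range f)"
      "\<And>k. k \<in> K \<Longrightarrow> (LINT t|M k. cmod (f t - g t)) < \<epsilon>"
      by (rule approximableE[OF g \<open>\<epsilon> > 0\<close>]) blast
    \<comment> \<open>Retracting \<open>f\<close> onto the unit disc does not move it away from \<open>g\<close>.\<close>
    have rf: "continuous_on UNIV (\<lambda>t. ?r (f t))"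
      by (rule continuous_on_compose2[OF continuous_on_closest_point f(1)]) auto
    have rf_le: "cmod (?r (f t)) \<le> 1" for t
      using closest_point_in_set[of "cball (0::complex) 1" "f t"] by simp
    have closer: "cmod (?r (f t) - g t) \<le> cmod (f t - g t)" for t
      using closest_point_lipschitz[of "cball (0::complex) 1" "f t" "g t"] g_le
      by (simp add: closest_point_self dist_norm)
    have "(LINT t|M k. cmod (?r (f t) - g t)) \<le> \<epsilon>" if k: "k \<in> K" for k
    proof -
      have "(LINT t|M k. cmod (?r (f t) - g t)) \<le> (LINT t|M k. cmod (f t - g t))"
        using f approximableD[OF g] borel_measurable_continuous_onI[OF rf] rf_le
        by (intro integral_mono closer integrable_dist k) (auto simp: bounded_iff)
      then show ?thesis using f(4)[OF k] by linarith
    qed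
    from functional_diff_le[OF borel_measurable_continuous_onI[OF rf] rf_le
        approximableD(1)[OF g] g_le this]
    have "cmod (functional (\<lambda>t. ?r (f t)) - functional g) \<le> C * \<epsilon>"
      by (simp add: C_def sum_distrib_right)
    moreover have "cmod (functional (\<lambda>t. ?r (f t))) \<le> v" by (rule v[OF rf rf_le])
    moreover have "cmod (functional g) \<le> cmod (functional (\<lambda>t. ?r (f t))) +
        cmod (functional (\<lambda>t. ?r (f t)) - functional g)"
      using norm_triangle_sub[of "functional g"] by (subst norm_minus_commute)
    ultimately show "(\<Sum>\<alpha>\<in>P. cmod (charge \<alpha>)) \<le> v + e"
      using Fg \<open>C * \<epsilon> \<le> e\<close> by linarith
  qed
qed

end



section \<open>Integration against complex measures\<close>

lemma measure_combination_diff: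
  fixes M :: "'k \<Rightarrow> 'a::topological_space measure" and M' :: "'l \<Rightarrow> 'a measure"
    and c :: "'k \<Rightarrow> complex" and c' :: "'l \<Rightarrow> complex"
  assumes "measure_combination K M" "measure_combination K' M'"
  defines "c'' \<equiv> case_sum c (\<lambda>k. - c' k)" and "M'' \<equiv> case_sum M M'"
  shows "measure_combination (K <+> K') M''"
    and "measure_combination.charge (K <+> K') c'' M'' \<alpha> =
      measure_combination.charge K c M \<alpha> - measure_combination.charge K' c' M' \<alpha>"
    and "measure_combination.functional (K <+> K') c'' M'' f =
      measure_combination.functional K c M f - measure_combination.functional K' c' M' f"
proof -
  interpret A: measure_combination K c M by (rule assms)
  interpret B: measure_combination K' c' M' by (rule assms)
  show *: "measure_combination (K <+> K') M''"
  proof (rule measure_combination.intro)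
    show "finite (K <+> K')" by (intro finite_Plus A.finite_K B.finite_K)
    show "sets (M'' k) = sets borel" if "k \<in> K <+> K'" for k
      using that unfolding M''_def by (elim PlusE) (simp_all add: A.sets_M B.sets_M)
    show "finite_measure (M'' k)" if "k \<in> K <+> K'" for k
      using that unfolding M''_def by (elim PlusE) (simp_all add: A.finite_M B.finite_M)
  qed
  interpret D: measure_combination "K <+> K'" c'' M'' by (rule *)
  show "D.charge \<alpha> = A.charge \<alpha> - B.charge \<alpha>"
    unfolding D.charge_def A.charge_def B.charge_def
    unfolding c''_def M''_def
    by (simp add: sum.Plus A.finite_K B.finite_K sum_negf)
  show "D.functional f = A.functional f - B.functional f"
    unfolding D.functional_def A.functional_def B.functional_def
    unfolding c''_def M''_def
    by (simp add: sum.Plus A.finite_K B.finite_K sum_negf)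
qed

lemma measure_combination_functional_eqI:
  assumes "measure_combination K M" "measure_combination K' M'"
    and charge: "\<And>\<alpha>. \<alpha> \<in> sets borel \<Longrightarrow>
      measure_combination.charge K c M \<alpha> = measure_combination.charge K' c' M' \<alpha>"
    and f: "f \<in> borel_measurable borel" "\<And>t. cmod (f t) \<le> B"
  shows "measure_combination.functional K c M f = measure_combination.functional K' c' M' f"
proof -
  note diff = measure_combination_diff[OF assms(1,2)]
  have "cmod (measure_combination.functional K c M f - measure_combination.functional K' c' M' f)
      \<le> B * 0"
    unfolding diff(3)[symmetric]
    by (rule measure_combination.functional_le_variation[OF diff(1) f])
      (use charge in \<open>auto simp: diff(2) intro!: sum_nonpos\<close>)
  then show ?thesis by simp
qed

lemma four_term_charge_functional:
  assumes "\<forall>k<4::nat. sets (M k) = sets borel \<and> finite_measure (M k)"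
  shows "measure_combination {..<4} M"
    and "measure_combination.charge {..<4} (\<lambda>k. \<i> ^ k) M \<alpha> =
      (\<Sum>k<4. \<i> ^ k * complex_of_real (measure (M k) \<alpha>))"
    and "measure_combination.functional {..<4} (\<lambda>k. \<i> ^ k) M f = (\<Sum>k<4. \<i> ^ k * (LINT t|M k. f t))"
proof -
  show *: "measure_combination {..<4} M" using assms by (simp add: measure_combination_def)
  interpret measure_combination "{..<4}" "\<lambda>k. \<i> ^ k" M by (rule *)
  show "charge \<alpha> = (\<Sum>k<4. \<i> ^ k * complex_of_real (measure (M k) \<alpha>))" by (rule charge_def)
  show "functional f = (\<Sum>k<4. \<i> ^ k * (LINT t|M k. f t))" by (rule functional_def)
qed

text \<open>The definite description in the definition of the integral is legitimate because two
  representations of one complex measure have the same functional.\<close>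

lemma complex_measure_integral_eq_functional:
  assumes M: "measure_combination {..<4} M"
    and charge: "\<And>\<alpha>. \<alpha> \<in> sets borel \<Longrightarrow>
      measure_combination.charge {..<4} (\<lambda>k. \<i> ^ k) M \<alpha> = \<mu> \<alpha>"
    and f: "f \<in> borel_measurable borel" "\<And>t. cmod (f t) \<le> B"
  shows "complex_measure_integral \<mu> f = measure_combination.functional {..<4} (\<lambda>k. \<i> ^ k) M f"
    (is "_ = ?I")
  unfolding complex_measure_integral_def
proof (rule the_equality)
  have M': "\<forall>k<4. sets (M k) = sets borel \<and> finite_measure (M k)"
    using M by (simp add: measure_combination_def)
  note M'' = four_term_charge_functional(2,3)[OF M']
  show "\<exists>M. (\<forall>k<4. sets (M k) = sets borel \<and> finite_measure (M k)) \<and>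
      (\<forall>\<alpha>\<in>sets borel. \<mu> \<alpha> = (\<Sum>k<4. \<i> ^ k * complex_of_real (measure (M k) \<alpha>))) \<and>
      ?I = (\<Sum>k<4. \<i> ^ k * (LINT t|M k. f t))"
    by (intro exI[of _ M] conjI M' M''(2) ballI) (simp only: charge[symmetric] M''(1))
  fix I
  assume "\<exists>N. (\<forall>k<4. sets (N k) = sets borel \<and> finite_measure (N k)) \<and>
      (\<forall>\<alpha>\<in>sets borel. \<mu> \<alpha> = (\<Sum>k<4. \<i> ^ k * complex_of_real (measure (N k) \<alpha>))) \<and>
      I = (\<Sum>k<4. \<i> ^ k * (LINT t|N k. f t))"
  then show "I = ?I"
  proof (elim exE conjE)
    fix N
    assume N: "\<forall>k<4. sets (N k) = sets borel \<and> finite_measure (N k)"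
      and \<mu>: "\<forall>\<alpha>\<in>sets borel. \<mu> \<alpha> = (\<Sum>k<4. \<i> ^ k * complex_of_real (measure (N k) \<alpha>))"
      and I: "I = (\<Sum>k<4. \<i> ^ k * (LINT t|N k. f t))"
    note N' = four_term_charge_functional[OF N]
    show "I = ?I"
      unfolding I N'(3)[symmetric]
      by (rule measure_combination_functional_eqI[OF N'(1) M _ f])
        (simp only: charge N'(2) \<mu>[rule_format])
  qed
qed


section \<open>The matrix coefficients of a quantum probability measure\<close>

text \<open>The factor \<open>1/2\<close> absorbs the \<open>1/4\<close> of the polarization identity, which leaves the coefficients
  \<open>\<i>\<^sup>k\<close> that the integral against a complex measure prescribes.\<close>

definition polarization_vector :: "'h::complex_hilbert_space \<Rightarrow> 'h \<Rightarrow> nat \<Rightarrow> 'h" where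
  "polarization_vector \<xi> \<eta> k = (1/2) *\<^sub>R (\<xi> + (\<i> ^ k) *\<^sub>C \<eta>)"

text \<open>The inner product is conjugate linear in \<open>\<eta>\<close>, so the term \<open>\<langle>T \<xi>, \<i>\<^sup>k \<eta>\<rangle>\<close> is the one that
  the factor \<open>\<i>\<^sup>k\<close> turns into \<open>\<langle>T \<xi>, \<eta>\<rangle>\<close>; the other three cancel in the sum over \<open>k\<close>.\<close>

lemma polarization:
  assumes "T \<in> bounded_ops"
  shows "cinner (blinfun_apply T \<xi>) \<eta> =
    (\<Sum>k<4. \<i> ^ k * cinner (blinfun_apply T (polarization_vector \<xi> \<eta> k)) (polarization_vector \<xi> \<eta> k))"
proof -
  have T: "blinfun_apply T (c *\<^sub>C x) = c *\<^sub>C blinfun_apply T x" for c x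
    using assms by (simp add: bounded_ops_def)
  let ?q = "\<lambda>x y. cinner (blinfun_apply T x) y"
  have expand: "?q (polarization_vector \<xi> \<eta> k) (polarization_vector \<xi> \<eta> k) =
      (?q \<xi> \<xi> + cnj (\<i> ^ k) * ?q \<xi> \<eta> + \<i> ^ k * ?q \<eta> \<xi> + \<i> ^ k * (cnj (\<i> ^ k) * ?q \<eta> \<eta>)) / 4" for k
    unfolding polarization_vector_def blinfun.scaleR_right blinfun.add_right T cinner_scaleR_left
      cinner_scaleR_right cinner_add_left cinner_add_right cinner_scaleC_left cinner_scaleC_right
    by (simp add: field_simps)
  have four: "(\<Sum>k<4. g k) = g 0 + g 1 + g 2 + g 3" for g :: "nat \<Rightarrow> complex"
    by (simp add: eval_nat_numeral)
  have "\<i> ^ 3 = - \<i>" by (simp add: power3_eq_cube)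
  then show ?thesis
    unfolding four expand by (simp add: field_simps)
qed

lemma norm_polarization_vector_le: "norm (polarization_vector \<xi> \<eta> k) \<le> (norm \<xi> + norm \<eta>) / 2"
  using norm_triangle_ineq[of \<xi> "(\<i> ^ k) *\<^sub>C \<eta>"]
  by (simp add: polarization_vector_def norm_scaleC norm_power)

definition form_measure ::
    "('a::topological_space set \<Rightarrow> ('h::complex_hilbert_space \<Rightarrow>\<^sub>L 'h)) \<Rightarrow> 'h \<Rightarrow> 'a measure" where
  "form_measure E \<zeta> = measure_of UNIV (sets borel) (\<lambda>\<alpha>. ennreal (Re (coeff_measure E \<zeta> \<zeta> \<alpha>)))"

lemma sets_form_measure [simp]: "sets (form_measure E \<zeta>) = sets borel"
  using sigma_algebra.sigma_sets_eq[OF sets.sigma_algebra_axioms[of borel]]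
  by (simp add: form_measure_def)

lemma space_form_measure [simp]: "space (form_measure E \<zeta>) = UNIV"
  using sets_eq_imp_space_eq[OF sets_form_measure] by simp

lemma quantum_prob_measuresD:
  assumes "E \<in> quantum_prob_measures"
  shows "\<alpha> \<in> sets borel \<Longrightarrow> E \<alpha> \<in> bounded_ops"
    and "\<alpha> \<in> sets borel \<Longrightarrow> coeff_measure E \<zeta> \<zeta> \<alpha> \<in> \<real>\<^sub>\<ge>\<^sub>0"
    and "E {} = 0" "E UNIV = id_blinfun"
    and "range \<delta> \<subseteq> sets borel \<Longrightarrow> disjoint_family \<delta> \<Longrightarrow>
      (\<lambda>n. coeff_measure E \<xi> \<eta> (\<delta> n)) sums coeff_measure E \<xi> \<eta> (\<Union>n. \<delta> n)"
  using assms
  by (auto simp: quantum_prob_measures_def positive_op_def coeff_measure_def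
      intro!: bounded_linear.sums[OF bounded_linear_cinner_left])

lemma emeasure_form_measure:
  assumes E: "E \<in> quantum_prob_measures" and \<alpha>: "\<alpha> \<in> sets borel"
  shows "emeasure (form_measure E \<zeta>) \<alpha> = ennreal (Re (coeff_measure E \<zeta> \<zeta> \<alpha>))"
proof (rule emeasure_measure_of[OF form_measure_def])
  note D = quantum_prob_measuresD[OF E]
  show "sets borel \<subseteq> Pow UNIV" by simp
  show "\<alpha> \<in> sets (form_measure E \<zeta>)" using \<alpha> by simp
  show "positive (sets (form_measure E \<zeta>)) (\<lambda>\<alpha>. ennreal (Re (coeff_measure E \<zeta> \<zeta> \<alpha>)))"
    by (simp add: positive_def coeff_measure_def D(3) cinner_zero_left)
  show "countably_additive (sets (form_measure E \<zeta>)) (\<lambda>\<alpha>. ennreal (Re (coeff_measure E \<zeta> \<zeta> \<alpha>)))"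
  proof (rule countably_additiveI)
    fix \<delta> :: "nat \<Rightarrow> 'a set"
    assume \<delta>: "range \<delta> \<subseteq> sets (form_measure E \<zeta>)" "disjoint_family \<delta>"
    have "0 \<le> Re (coeff_measure E \<zeta> \<zeta> (\<delta> n))" for n
      using D(2)[of "\<delta> n" \<zeta>] \<delta>(1) by (auto simp: complex_nonneg_Reals_iff)
    moreover have "(\<lambda>n. Re (coeff_measure E \<zeta> \<zeta> (\<delta> n))) sums Re (coeff_measure E \<zeta> \<zeta> (\<Union>n. \<delta> n))"
      using D(5) \<delta> by (intro sums_Re) simp
    ultimately show "(\<Sum>n. ennreal (Re (coeff_measure E \<zeta> \<zeta> (\<delta> n)))) =
        ennreal (Re (coeff_measure E \<zeta> \<zeta> (\<Union>n. \<delta> n)))"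
      by (rule suminf_ennreal_eq)
  qed
qed

lemma measure_form_measure:
  assumes E: "E \<in> quantum_prob_measures" and \<alpha>: "\<alpha> \<in> sets borel"
  shows "complex_of_real (measure (form_measure E \<zeta>) \<alpha>) = coeff_measure E \<zeta> \<zeta> \<alpha>"
  using quantum_prob_measuresD(2)[OF E \<alpha>, of \<zeta>] emeasure_form_measure[OF E \<alpha>, of \<zeta>]
  by (auto simp: measure_def complex_nonneg_Reals_iff complex_eq_iff)

lemma finite_form_measure:
  assumes "E \<in> quantum_prob_measures"
  shows "finite_measure (form_measure E \<zeta>)"
  using emeasure_form_measure[OF assms, of UNIV \<zeta>]
  by (intro finite_measureI) simp

text \<open>Positivity of \<open>E\<close> makes only the diagonal coefficients positive measures; polarization reaches the
  others.  The mass of \<open>E\<^sub>\<zeta>\<^sub>,\<^sub>\<zeta>\<close> is \<open>\<parallel>\<zeta>\<parallel>\<^sup>2\<close> because \<open>E(A)\<close> is the identity.\<close>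

lemma coeff_measure_combination:
  assumes E: "E \<in> quantum_prob_measures"
  defines "M \<equiv> \<lambda>\<xi> \<eta> k. form_measure E (polarization_vector \<xi> \<eta> k)"
  shows "measure_combination {..<4::nat} (M \<xi> \<eta>)"
    and "\<alpha> \<in> sets borel \<Longrightarrow>
      measure_combination.charge {..<4} (\<lambda>k. \<i> ^ k) (M \<xi> \<eta>) \<alpha> = coeff_measure E \<xi> \<eta> \<alpha>"
    and "(\<Sum>k<4. cmod (\<i> ^ k) * measure (M \<xi> \<eta> k) UNIV) \<le> (norm \<xi> + norm \<eta>)\<^sup>2"
proof -
  show *: "measure_combination {..<4::nat} (M \<xi> \<eta>)"
    using finite_form_measure[OF E] by (simp add: measure_combination_def M_def)
  show "measure_combination.charge {..<4} (\<lambda>k. \<i> ^ k) (M \<xi> \<eta>) \<alpha> = coeff_measure E \<xi> \<eta> \<alpha>"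
    if "\<alpha> \<in> sets borel"
    using that polarization[OF quantum_prob_measuresD(1)[OF E that], of \<xi> \<eta>]
    unfolding measure_combination.charge_def[OF *]
    by (simp add: M_def measure_form_measure[OF E] coeff_measure_def)
  have "measure (form_measure E \<zeta>) UNIV = (norm \<zeta>)\<^sup>2" for \<zeta>
    using measure_form_measure[OF E, of UNIV \<zeta>]
    by (simp add: coeff_measure_def quantum_prob_measuresD[OF E] cinner_self del: of_real_power)
  then have "measure (M \<xi> \<eta> k) UNIV \<le> ((norm \<xi> + norm \<eta>) / 2)\<^sup>2" for k
    by (simp only: M_def power_mono[OF norm_polarization_vector_le norm_ge_zero])
  then have "(\<Sum>k<4. cmod (\<i> ^ k) * measure (M \<xi> \<eta> k) UNIV) \<le>
      (\<Sum>k<4::nat. ((norm \<xi> + norm \<eta>) / 2)\<^sup>2)"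
    by (intro sum_mono) (simp add: norm_power)
  then show "(\<Sum>k<4. cmod (\<i> ^ k) * measure (M \<xi> \<eta> k) UNIV) \<le> (norm \<xi> + norm \<eta>)\<^sup>2"
    by (simp add: power_divide)
qed

text \<open>The total mass of the polarization of \<open>E\<^sub>\<xi>\<^sub>,\<^sub>\<eta>\<close> is bounded by the norms of \<open>\<xi>\<close> and \<open>\<eta>\<close>, so
  Riemann sums converge uniformly over unit vectors and over all \<open>E\<close>.\<close>

lemma coeff_integral_approx:
  assumes E: "E \<in> quantum_prob_measures"
    and f: "f \<in> borel_measurable borel" "\<And>t. cmod (f t) \<le> B" and P: "fine_partition f \<epsilon> P" "0 \<le> \<epsilon>"
  shows "cmod (complex_measure_integral (coeff_measure E \<xi> \<eta>) f -
      step_sum f P (coeff_measure E \<xi> \<eta>)) \<le> \<epsilon> * (norm \<xi> + norm \<eta>)\<^sup>2"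
proof -
  note comb = coeff_measure_combination[OF E, where \<xi> = \<xi> and \<eta> = \<eta>]
  have "step_sum f P (coeff_measure E \<xi> \<eta>) = step_sum f P
      (measure_combination.charge {..<4} (\<lambda>k. \<i> ^ k) (\<lambda>k. form_measure E (polarization_vector \<xi> \<eta> k)))"
    unfolding step_sum_def using P(1)
    by (intro sum.cong) (auto simp: comb(2) fine_partition_def subset_iff)
  with measure_combination.functional_step_sum[OF comb(1) f P(1)]
    complex_measure_integral_eq_functional[OF comb(1,2) f]
  show ?thesis
    using order_trans[OF _ mult_left_mono[OF comb(3) P(2)]] by simp
qed



section \<open>The map of a quantum probability measure\<close>

definition scaled_op :: "complex \<Rightarrow> ('h::complex_hilbert_space \<Rightarrow>\<^sub>L 'h) \<Rightarrow> ('h \<Rightarrow>\<^sub>L 'h)" where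
  "scaled_op a T = Blinfun (\<lambda>\<xi>. a *\<^sub>C blinfun_apply T \<xi>)"

lemma scaled_op_apply: "blinfun_apply (scaled_op a T) \<xi> = a *\<^sub>C blinfun_apply T \<xi>"
  unfolding scaled_op_def
  by (subst bounded_linear_Blinfun_apply)
    (auto intro: bounded_linear_compose[OF bounded_linear_scaleC blinfun.bounded_linear_right])

lemma bounded_ops_scaled_op: "T \<in> bounded_ops \<Longrightarrow> scaled_op a T \<in> bounded_ops"
  by (simp add: bounded_ops_def scaled_op_apply scaleC_scaleC mult.commute)

lemma bounded_ops_sum: "(\<And>i. i \<in> I \<Longrightarrow> T i \<in> bounded_ops) \<Longrightarrow> (\<Sum>i\<in>I. T i) \<in> bounded_ops"
  by (induction I rule: infinite_finite_induct) (simp_all add: bounded_ops_0 bounded_ops_add)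

lemma bounded_ops_limit:
  assumes "\<And>n. S n \<in> bounded_ops" "S \<longlonglongrightarrow> T"
  shows "T \<in> bounded_ops"
  unfolding bounded_ops_def
proof (intro CollectI allI)
  fix c \<xi>
  have lim: "(\<lambda>n. blinfun_apply (S n) x) \<longlonglongrightarrow> blinfun_apply T x" for x
    by (rule bounded_linear.tendsto[OF blinfun.bounded_linear_left assms(2)])
  have "(\<lambda>n. blinfun_apply (S n) (c *\<^sub>C \<xi>)) \<longlonglongrightarrow> c *\<^sub>C blinfun_apply T \<xi>"
    using assms(1) bounded_linear.tendsto[OF bounded_linear_scaleC lim]
    by (simp add: bounded_ops_def)
  then show "blinfun_apply T (c *\<^sub>C \<xi>) = c *\<^sub>C blinfun_apply T \<xi>"
    by (rule LIMSEQ_unique[OF lim])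
qed

text \<open>The operator is the norm limit of the Riemann sums \<open>\<Sum> f(t\<^sub>\<alpha>) E(\<alpha>)\<close>: these are Cauchy, since
  their matrix coefficients converge uniformly over unit vectors.\<close>

lemma ex_operator_of_integrals:
  assumes E: "E \<in> quantum_prob_measures"
    and f: "f \<in> borel_measurable borel" "\<And>t. cmod (f t) \<le> B"
  shows "\<exists>T\<in>bounded_ops. \<forall>\<xi> \<eta>. cinner (blinfun_apply T \<xi>) \<eta> =
    complex_measure_integral (coeff_measure E \<xi> \<eta>) f"
proof -
  let ?e = "\<lambda>n. inverse (real (Suc n))" and ?I = "\<lambda>\<xi> \<eta>. complex_measure_integral (coeff_measure E \<xi> \<eta>) f"
  have "\<exists>P. fine_partition f (?e n) P" for n by (rule ex_fine_partition[OF f]) simp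
  then obtain P where P: "\<And>n. fine_partition f (?e n) (P n)" by metis
  define S where "S n = (\<Sum>\<alpha>\<in>P n. scaled_op (f (SOME t. t \<in> \<alpha>)) (E \<alpha>))" for n
  have S_ops: "S n \<in> bounded_ops" for n
    unfolding S_def using P quantum_prob_measuresD(1)[OF E]
    by (intro bounded_ops_sum bounded_ops_scaled_op) (auto simp: fine_partition_def subset_iff)
  have S_inner: "cinner (blinfun_apply (S n) \<xi>) \<eta> = step_sum f (P n) (coeff_measure E \<xi> \<eta>)" for n \<xi> \<eta>
    by (simp add: S_def step_sum_def blinfun.sum_left cinner_sum_left scaled_op_apply
        cinner_scaleC_left coeff_measure_def)
  have approx: "cmod (?I \<xi> \<eta> - cinner (blinfun_apply (S n) \<xi>) \<eta>) \<le> ?e n * (norm \<xi> + norm \<eta>)\<^sup>2" for n \<xi> \<eta>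
    unfolding S_inner by (rule coeff_integral_approx[OF E f P]) simp
  have close: "norm (S m - S n) \<le> 4 * ?e m + 4 * ?e n" for m n
  proof (rule norm_blinfun_le_unit_forms)
    fix \<xi> \<eta> :: 'b assume "norm \<xi> = 1" "norm \<eta> = 1"
    then have "cmod (?I \<xi> \<eta> - cinner (blinfun_apply (S n) \<xi>) \<eta>) \<le> 4 * ?e n" for n
      using approx[of \<xi> \<eta> n] by (simp add: mult.commute)
    from norm_triangle_le_diff[OF add_mono[OF this[of n] this[of m]]]
    show "cmod (cinner (blinfun_apply (S m - S n) \<xi>) \<eta>) \<le> 4 * ?e m + 4 * ?e n"
      by (simp add: blinfun.diff_left cinner_diff_left add.commute)
  qed simp
  have "Cauchy S"
  proof (rule CauchyI)
    fix e :: real assume "e > 0"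
    then have "e / 8 > 0" by simp
    then obtain N where N: "?e N < e / 8" using reals_Archimedean by blast
    have "norm (S m - S n) < e" if "N \<le> m" "N \<le> n" for m n
    proof -
      have "?e m \<le> ?e N" "?e n \<le> ?e N" using that by (auto intro: le_imp_inverse_le)
      then show ?thesis using close[of m n] N by linarith
    qed
    then show "\<exists>M. \<forall>m\<ge>M. \<forall>n\<ge>M. norm (S m - S n) < e" by blast
  qed
  then obtain T where T: "S \<longlonglongrightarrow> T" by (auto simp: Cauchy_convergent_iff convergent_def)
  have "cinner (blinfun_apply T \<xi>) \<eta> = ?I \<xi> \<eta>" for \<xi> \<eta>
  proof (rule LIMSEQ_unique)
    show "(\<lambda>n. cinner (blinfun_apply (S n) \<xi>) \<eta>) \<longlonglongrightarrow> cinner (blinfun_apply T \<xi>) \<eta>"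
      by (intro bounded_linear.tendsto[OF bounded_linear_cinner_left]
          bounded_linear.tendsto[OF blinfun.bounded_linear_left] T)
    have "(\<lambda>n. ?e n * (norm \<xi> + norm \<eta>)\<^sup>2) \<longlonglongrightarrow> 0 * (norm \<xi> + norm \<eta>)\<^sup>2"
      by (intro tendsto_mult_right LIMSEQ_inverse_real_of_nat)
    then have "(\<lambda>n. ?e n * (norm \<xi> + norm \<eta>)\<^sup>2) \<longlonglongrightarrow> 0" by simp
    then have "(\<lambda>n. ?I \<xi> \<eta> - cinner (blinfun_apply (S n) \<xi>) \<eta>) \<longlonglongrightarrow> 0"
      by (rule Lim_null_comparison[OF always_eventually, rotated]) (use approx in blast)
    from tendsto_diff[OF tendsto_const[of "?I \<xi> \<eta>"] this]
    show "(\<lambda>n. cinner (blinfun_apply (S n) \<xi>) \<eta>) \<longlonglongrightarrow> ?I \<xi> \<eta>" by simp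
  qed
  moreover have "T \<in> bounded_ops" by (rule bounded_ops_limit[OF S_ops T])
  ultimately show ?thesis by blast
qed

lemma bcontfun_measurable: "apply_bcontfun f \<in> borel_measurable borel"
  using apply_bcontfun[of f] by (intro borel_measurable_continuous_onI) (simp add: bcontfun_def)

lemma
  assumes E: "E \<in> quantum_prob_measures"
  shows phi_bounded_ops: "phi E f \<in> bounded_ops"
    and cinner_phi: "cinner (blinfun_apply (phi E f) \<xi>) \<eta> =
      complex_measure_integral (coeff_measure E \<xi> \<eta>) (apply_bcontfun f)"
proof -
  let ?Q = "\<lambda>T. T \<in> bounded_ops \<and> (\<forall>\<xi> \<eta>. cinner (blinfun_apply T \<xi>) \<eta> =
      complex_measure_integral (coeff_measure E \<xi> \<eta>) (apply_bcontfun f))"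
  obtain T where "?Q T"
    using ex_operator_of_integrals[OF E bcontfun_measurable norm_bounded, of f] by blast
  moreover have "S = T" if "?Q S" for S
    by (rule blinfun_eqI_cinner) (use that \<open>?Q T\<close> in simp)
  ultimately have "?Q (phi E f)" unfolding phi_def by (rule theI)
  then show "phi E f \<in> bounded_ops" "cinner (blinfun_apply (phi E f) \<xi>) \<eta> =
      complex_measure_integral (coeff_measure E \<xi> \<eta>) (apply_bcontfun f)" by auto
qed

text \<open>The true constant is one; any bound that does not depend on \<open>E\<close> suffices for \<open>\<Phi>\<^sub>E(f)\<close> to be a
  bounded function and for the operator norm of \<open>\<Phi>\<^sub>E - \<Phi>\<^sub>F\<close> to be a finite supremum.\<close>

lemma norm_phi_le:
  assumes E: "E \<in> quantum_prob_measures"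
  shows "norm (phi E f) \<le> 4 * norm f"
proof (rule norm_blinfun_le_unit_forms)
  fix \<xi> \<eta> :: 'b assume unit: "norm \<xi> = 1" "norm \<eta> = 1"
  note comb = coeff_measure_combination[OF E, where \<xi> = \<xi> and \<eta> = \<eta>]
  interpret measure_combination "{..<4}" "\<lambda>k. \<i> ^ k" "\<lambda>k. form_measure E (polarization_vector \<xi> \<eta> k)"
    by (rule comb(1))
  have "cmod (functional (apply_bcontfun f)) \<le>
      norm f * (\<Sum>k<4. cmod (\<i> ^ k) * measure (form_measure E (polarization_vector \<xi> \<eta> k)) UNIV)"
    by (rule functional_le_mass[OF bcontfun_measurable norm_bounded])
  also have "\<dots> \<le> norm f * 4"
    using comb(3) unit by (intro mult_left_mono) simp_all
  finally show "cmod (cinner (blinfun_apply (phi E f) \<xi>) \<eta>) \<le> 4 * norm f"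
    using complex_measure_integral_eq_functional[OF comb(1,2) bcontfun_measurable norm_bounded]
    by (simp add: cinner_phi[OF E] mult.commute)
qed simp

text \<open>The theorem for a single point \<open>x\<close>.  For unit vectors \<open>\<xi>\<close>, \<open>\<eta>\<close>, the number
  \<open>\<langle>(\<phi>\<^sub>E(f) - \<phi>\<^sub>F(f)) \<xi>, \<eta>\<rangle>\<close> is the integral of \<open>f\<close> against \<open>E\<^sub>\<xi>\<^sub>,\<^sub>\<eta> - F\<^sub>\<xi>\<^sub>,\<^sub>\<eta>\<close>, whose norm as
  a functional on \<open>C(A)\<close> is the total variation; taking suprema over \<open>\<xi>\<close> and \<open>\<eta>\<close> on both sides gives
  the claim.  The form with a bound \<open>r\<close> lets suprema be compared without knowing that they are finite.\<close>

lemma qpm_dist_le_iff: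
  fixes E F :: "'a::{t2_space, second_countable_topology} set \<Rightarrow>
      ('h::complex_hilbert_space \<Rightarrow>\<^sub>L 'h)"
  assumes compact: "compact (UNIV :: 'a set)"
    and E: "E \<in> quantum_prob_measures" and F: "F \<in> quantum_prob_measures" and "0 \<le> r"
  shows "qpm_dist E F \<le> ennreal r \<longleftrightarrow> (\<forall>f. norm (phi E f - phi F f) \<le> r * norm f)"
proof -
  let ?\<mu> = "\<lambda>\<xi> \<eta> \<alpha>. coeff_measure E \<xi> \<eta> \<alpha> - coeff_measure F \<xi> \<eta> \<alpha>"
    and ?K = "{..<4::nat} <+> {..<4::nat}"
    and ?c = "case_sum (\<lambda>k. \<i> ^ k) (\<lambda>k. - (\<i> ^ k)) :: nat + nat \<Rightarrow> complex"
    and ?M = "\<lambda>\<xi> \<eta>. case_sum (\<lambda>k. form_measure E (polarization_vector \<xi> \<eta> k)) (\<lambda>k. form_measure F (polarization_vector \<xi> \<eta> k))"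
  note combE = coeff_measure_combination(1,2)[OF E] and combF = coeff_measure_combination(1,2)[OF F]
  note diff = measure_combination_diff[OF combE(1) combF(1)]
  have comb: "compact_measure_combination ?K (?M \<xi> \<eta>)" for \<xi> \<eta>
    using diff(1) compact
    by (simp add: compact_measure_combination_def compact_measure_combination_axioms_def)
  have charge: "measure_combination.charge ?K ?c (?M \<xi> \<eta>) \<alpha> = ?\<mu> \<xi> \<eta> \<alpha>"
    if "\<alpha> \<in> sets borel" for \<xi> \<eta> \<alpha>
    by (simp add: diff(2) combE(2) combF(2) that)
  have functional: "measure_combination.functional ?K ?c (?M \<xi> \<eta>) (apply_bcontfun f) =
      cinner (blinfun_apply (phi E f - phi F f) \<xi>) \<eta>" for \<xi> \<eta> f
    using complex_measure_integral_eq_functional[OF combE bcontfun_measurable norm_bounded]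
      complex_measure_integral_eq_functional[OF combF bcontfun_measurable norm_bounded]
    by (simp add: diff(3) blinfun.diff_left cinner_diff_left cinner_phi E F)
  have dist: "qpm_dist E F \<le> ennreal r \<longleftrightarrow>
      (\<forall>\<xi> \<eta> P. norm \<xi> = 1 \<longrightarrow> norm \<eta> = 1 \<longrightarrow> finite P \<longrightarrow> partition_on UNIV P \<longrightarrow>
        P \<subseteq> sets borel \<longrightarrow> (\<Sum>\<alpha>\<in>P. cmod (?\<mu> \<xi> \<eta> \<alpha>)) \<le> r)"
    using \<open>0 \<le> r\<close> by (auto simp: qpm_dist_def tv_norm_def SUP_le_iff ennreal_le_iff)
  show ?thesis
  proof
    assume le: "qpm_dist E F \<le> ennreal r"
    show "\<forall>f. norm (phi E f - phi F f) \<le> r * norm f"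
    proof (intro allI norm_blinfun_le_unit_forms)
      fix f :: "'a \<Rightarrow>\<^sub>C complex" and \<xi> \<eta> :: 'h assume unit: "norm \<xi> = 1" "norm \<eta> = 1"
      interpret compact_measure_combination ?K ?c "?M \<xi> \<eta>" by (rule comb)
      have "cmod (functional (apply_bcontfun f)) \<le> norm f * r"
      proof (rule functional_le_variation[OF bcontfun_measurable norm_bounded])
        fix P :: "'a set set"
        assume P: "finite P" "partition_on UNIV P" "P \<subseteq> sets borel"
        have "(\<Sum>\<alpha>\<in>P. cmod (charge \<alpha>)) = (\<Sum>\<alpha>\<in>P. cmod (?\<mu> \<xi> \<eta> \<alpha>))"
          using P(3) by (intro sum.cong) (auto simp: charge)
        then show "(\<Sum>\<alpha>\<in>P. cmod (charge \<alpha>)) \<le> r" using le P unit unfolding dist by simp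
      qed
      then show "cmod (cinner (blinfun_apply (phi E f - phi F f) \<xi>) \<eta>) \<le> r * norm f"
        by (simp add: functional mult.commute)
    qed (use \<open>0 \<le> r\<close> in simp)
  next
    assume le: "\<forall>f. norm (phi E f - phi F f) \<le> r * norm f"
    show "qpm_dist E F \<le> ennreal r"
      unfolding dist
    proof (intro allI impI)
      fix \<xi> \<eta> :: 'h and P :: "'a set set"
      assume unit: "norm \<xi> = 1" "norm \<eta> = 1"
        and P: "finite P" "partition_on UNIV P" "P \<subseteq> sets borel"
      interpret compact_measure_combination ?K ?c "?M \<xi> \<eta>" by (rule comb)
      have "(\<Sum>\<alpha>\<in>P. cmod (charge \<alpha>)) \<le> r"
      proof (rule variation_le_dual_norm[OF P])
        fix f :: "'a \<Rightarrow> complex"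
        assume f: "continuous_on UNIV f" "\<And>t. cmod (f t) \<le> 1"
        then have "f \<in> bcontfun" by (auto simp: bcontfun_def bounded_iff)
        then have app: "apply_bcontfun (Bcontfun f) = f" by (rule Bcontfun_inverse)
        have "norm (Bcontfun f) \<le> 1" by (rule norm_bound) (simp add: app f)
        have "cmod (functional f) \<le> norm (phi E (Bcontfun f) - phi F (Bcontfun f))"
          using functional[of \<xi> \<eta> "Bcontfun f"] cinner_blinfun_le_norm[OF unit]
          by (simp add: app)
        also have "\<dots> \<le> r * norm (Bcontfun f)" using le by blast
        also have "\<dots> \<le> r * 1"
          by (rule mult_left_mono[OF \<open>norm (Bcontfun f) \<le> 1\<close> \<open>0 \<le> r\<close>])
        finally show "cmod (functional f) \<le> r" by simp
      qed
      moreover have "(\<Sum>\<alpha>\<in>P. cmod (charge \<alpha>)) = (\<Sum>\<alpha>\<in>P. cmod (?\<mu> \<xi> \<eta> \<alpha>))"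
        using P(3) by (intro sum.cong) (auto simp: charge)
      ultimately show "(\<Sum>\<alpha>\<in>P. cmod (?\<mu> \<xi> \<eta> \<alpha>)) \<le> r" by simp
    qed
  qed
qed


section \<open>The map of a channel\<close>

lemma channelsD:
  assumes "E \<in> channels"
  shows "E x \<in> quantum_prob_measures"
    and "\<alpha> \<in> sets borel \<Longrightarrow> (\<lambda>x. coeff_measure (E x) \<xi> \<eta> \<alpha>) \<in> borel_measurable borel"
  using assms by (auto simp: channels_def)

text \<open>One sequence of partitions, chosen for \<open>f\<close>, works for all \<open>x\<close>, and each Riemann sum is a finite
  combination of the measurable functions \<open>x \<mapsto> \<langle>E(\<alpha>|x) \<xi>, \<eta>\<rangle>\<close>.\<close>

lemma phi_coeff_measurable:
  assumes E: "E \<in> channels"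
  shows "(\<lambda>x. cinner (blinfun_apply (phi (E x) f) \<xi>) \<eta>) \<in> borel_measurable borel"
proof -
  let ?e = "\<lambda>n. inverse (real (Suc n))"
  have "\<exists>P. fine_partition (apply_bcontfun f) (?e n) P" for n
    by (rule ex_fine_partition[OF bcontfun_measurable norm_bounded]) simp
  then obtain P where P: "\<And>n. fine_partition (apply_bcontfun f) (?e n) (P n)" by metis
  let ?s = "\<lambda>n x. step_sum (apply_bcontfun f) (P n) (coeff_measure (E x) \<xi> \<eta>)"
  show ?thesis
  proof (rule borel_measurable_LIMSEQ_metric)
    show "?s n \<in> borel_measurable borel" for n
      unfolding step_sum_def using P[of n] channelsD(2)[OF E]
      by (intro borel_measurable_sum borel_measurable_times borel_measurable_const)
        (auto simp: fine_partition_def)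
    fix x
    have "(\<lambda>n. ?e n * (norm \<xi> + norm \<eta>)\<^sup>2) \<longlonglongrightarrow> 0 * (norm \<xi> + norm \<eta>)\<^sup>2"
      by (intro tendsto_mult_right LIMSEQ_inverse_real_of_nat)
    then have null: "(\<lambda>n. ?e n * (norm \<xi> + norm \<eta>)\<^sup>2) \<longlonglongrightarrow> 0" by simp
    have "cmod (cinner (blinfun_apply (phi (E x) f) \<xi>) \<eta> - ?s n x) \<le>
        ?e n * (norm \<xi> + norm \<eta>)\<^sup>2" for n
      unfolding cinner_phi[OF channelsD(1)[OF E]]
      by (rule coeff_integral_approx[OF channelsD(1)[OF E] bcontfun_measurable norm_bounded P]) simp
    with null have "(\<lambda>n. cinner (blinfun_apply (phi (E x) f) \<xi>) \<eta> - ?s n x) \<longlonglongrightarrow> 0"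
      by (intro Lim_null_comparison[OF always_eventually null]) blast
    from tendsto_diff[OF tendsto_const[of "cinner (blinfun_apply (phi (E x) f) \<xi>) \<eta>"] this]
    show "(\<lambda>n. ?s n x) \<longlonglongrightarrow> cinner (blinfun_apply (phi (E x) f) \<xi>) \<eta>" by simp
  qed
qed

text \<open>Places \<open>x \<mapsto> \<phi>\<^bsub>E x\<^esub>(f)\<close> in the domain of \<open>Abs_linf\<close>; normal functionals are pointwise
  limits of sums of vector functionals, so measurability passes to them from the matrix coefficients.\<close>

lemma phi_wstar_bounded:
  assumes E: "E \<in> channels"
  shows "(\<lambda>x. phi (E x) f) \<in> wstar_bounded"
  unfolding wstar_bounded_def
proof (intro CollectI conjI ballI)
  note Ex = channelsD(1)[OF E]
  show "range (\<lambda>x. phi (E x) f) \<subseteq> bounded_ops" using phi_bounded_ops[OF Ex] by blast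
  show "bounded (range (\<lambda>x. phi (E x) f))" using norm_phi_le[OF Ex] by (auto simp: bounded_iff)
  fix \<omega> :: "('c \<Rightarrow>\<^sub>L 'c) \<Rightarrow> complex" assume "\<omega> \<in> normal_functionals"
  then obtain \<xi> \<eta> where \<omega>:
      "\<And>T. T \<in> bounded_ops \<Longrightarrow> (\<lambda>n. cinner (blinfun_apply T (\<xi> n)) (\<eta> n)) sums \<omega> T"
    by (auto simp: normal_functionals_def)
  show "(\<lambda>x. \<omega> (phi (E x) f)) \<in> borel_measurable borel"
  proof (rule borel_measurable_LIMSEQ_metric)
    show "(\<lambda>x. \<Sum>i<n. cinner (blinfun_apply (phi (E x) f) (\<xi> i)) (\<eta> i)) \<in> borel_measurable borel" for n
      by (intro borel_measurable_sum phi_coeff_measurable[OF E])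
    show "(\<lambda>n. \<Sum>i<n. cinner (blinfun_apply (phi (E x) f) (\<xi> i)) (\<eta> i)) \<longlonglongrightarrow> \<omega> (phi (E x) f)" for x
      using \<omega>[OF phi_bounded_ops[OF Ex]] by (simp add: sums_def)
  qed
qed

lemma apply_linf_Phi: "E \<in> channels \<Longrightarrow> apply_linf (Phi E f) x = phi (E x) f"
  unfolding Phi_def by (simp add: Abs_linf_inverse[OF phi_wstar_bounded])

lemma norm_linf_le_iff: "norm G \<le> b \<longleftrightarrow> (\<forall>x. norm (apply_linf G x) \<le> b)"
proof
  have "bdd_above (range (\<lambda>x. norm (apply_linf G x)))"
    by (rule bounded_imp_bdd_above) (simp add: bounded_norm_comp bounded_range_linf)
  then have "norm (apply_linf G x) \<le> norm G" for x
    unfolding norm_linf_def by (rule cSUP_upper[OF UNIV_I])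
  then show "norm G \<le> b \<Longrightarrow> \<forall>x. norm (apply_linf G x) \<le> b" by (blast intro: order_trans)
  show "\<forall>x. norm (apply_linf G x) \<le> b \<Longrightarrow> norm G \<le> b"
    unfolding norm_linf_def by (rule cSUP_least) auto
qed

lemma norm_Phi_diff_le_iff:
  assumes "E \<in> channels" "F \<in> channels"
  shows "norm (Phi E f - Phi F f) \<le> b \<longleftrightarrow> (\<forall>x. norm (phi (E x) f - phi (F x) f) \<le> b)"
  by (simp add: norm_linf_le_iff minus_linf.rep_eq apply_linf_Phi assms)

lemma channel_dist_le_iff:
  fixes E F :: "'x::topological_space \<Rightarrow> 'a::{t2_space, second_countable_topology} set \<Rightarrow>
      ('h::complex_hilbert_space \<Rightarrow>\<^sub>L 'h)"
  assumes "compact (UNIV :: 'a set)" "E \<in> channels" "F \<in> channels" "0 \<le> r"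
  shows "channel_dist E F \<le> ennreal r \<longleftrightarrow> (\<forall>f. norm (Phi E f - Phi F f) \<le> r * norm f)"
  using assms
  by (auto simp: channel_dist_def SUP_le_iff qpm_dist_le_iff channelsD norm_Phi_diff_le_iff)

theorem proposition3p4:
  fixes E F :: "'x::t2_space \<Rightarrow> 'a::{t2_space, second_countable_topology} set \<Rightarrow>
      ('h::complex_hilbert_space \<Rightarrow>\<^sub>L 'h)"
  assumes "compact (UNIV :: 'a set)"
    and "compact (UNIV :: 'x set)"
    and "separable_space (euclidean :: 'h topology)"
    and "E \<in> channels"
    and "F \<in> channels"
  shows "channel_dist E F = ennreal (onorm (\<lambda>f. Phi E f - Phi F f))"
proof (rule antisym)
  let ?D = "\<lambda>f. Phi E f - Phi F f"
  have bound: "norm (?D f) \<le> 8 * norm f" for f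
    unfolding norm_Phi_diff_le_iff[OF assms(4,5)]
  proof
    fix x
    show "norm (phi (E x) f - phi (F x) f) \<le> 8 * norm f"
      using norm_triangle_ineq4[of "phi (E x) f" "phi (F x) f"]
        norm_phi_le[OF channelsD(1)[OF assms(4)], of x f] norm_phi_le[OF channelsD(1)[OF assms(5)], of x f]
      by linarith
  qed
  have "bdd_above (range (\<lambda>f. norm (?D f) / norm f))"
    by (rule bdd_aboveI2[of _ _ 8]) (use bound in \<open>auto simp: divide_le_eq\<close>)
  then have quotient: "norm (?D f) / norm f \<le> onorm ?D" for f
    unfolding onorm_def by (rule cSUP_upper[OF UNIV_I])
  have onorm: "norm (?D f) \<le> onorm ?D * norm f" for f
  proof (cases "f = 0")
    case True
    then show ?thesis using bound[of f] by simp
  next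
    case False
    then show ?thesis using quotient[of f] by (simp add: divide_le_eq)
  qed
  have nonneg: "0 \<le> onorm ?D" using quotient[of 0] by simp
  show "channel_dist E F \<le> ennreal (onorm ?D)"
    using onorm by (simp add: channel_dist_le_iff[OF assms(1,4,5) nonneg])
  show "ennreal (onorm ?D) \<le> channel_dist E F"
  proof (cases "channel_dist E F")
    case (real r)
    then have "\<forall>f. norm (?D f) \<le> r * norm f"
      by (simp add: channel_dist_le_iff[OF assms(1,4,5), symmetric])
    then have "onorm ?D \<le> r" using real by (intro onorm_bound) auto
    then show ?thesis using real by (simp add: ennreal_leI)
  qed simp
qed

end
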